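(* Let $\Lambda=(\lambda_n)_{n\ge 1}$ be a sequence of non-zero complex numbers such that $\lambda_n\to\infty$ as $n\to+\infty$ and $i(\Lambda)=1$. Then the set $$\bigcap_{a\in\mathbb{C}\setminus\{0\}}HC(\{T_{\lambda_n a}\})$$ is a $G_\delta$ and dense subset of $(\mathcal{H}(\mathbb{C}),\mathcal{T}_u)$. In particular, there exists $f\in\mathcal{H}(\mathbb{C})$ such that for every $a\in\mathbb{C}\setminus\{0\}$ $$\overline{\{f(z+\lambda_n a)\mid n=1,2,\ldots\}}=\mathcal{H}(\mathbb{C}).$$
   Context: $\mathcal{H}(\mathbb{C})$ is the set of entire functions, endowed with the topology $\mathcal{T}_u$ of local uniform convergence (uniform convergence on compact subsets of $\mathbb{C}$); $\overline{A}$ denotes the closure of $A\subset\mathcal{H}(\mathbb{C})$ with respect to $\mathcal{T}_u$. A set is $G_\delta$ if it is a countable intersection of open sets. For $b\in\mathbb{C}\setminus\{0\}$, $T_b:\mathcal{H}(\mathbb{C})\to\mathcal{H}(\mathbb{C})$ is the translation operator $T_b(f)(z)=f(z+b)$. For a sequence $(T_n)$ of continuous linear operators on $\mathcal{H}(\mathbb{C})$, $HC(\{T_n\})$ is the set of all $f\in\mathcal{H}(\mathbb{C})$ such that $\{T_n(f):n=1,2,\ldots\}$ is dense in $\mathcal{H}(\mathbb{C})$; thus $HC(\{T_{\lambda_n a}\})$ is the set of entire $f$ for which the set of functions $\{z\mapsto f(z+\lambda_n a): n=1,2,\ldots\}$ is dense in $(\mathcal{H}(\mathbb{C}),\mathcal{T}_u)$.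 For a sequence $\Lambda=(\lambda_n)$ of non-zero complex numbers, $$i(\Lambda):=\inf\Big\{a\in\mathbb{R}\cup\{+\infty\}\ \Big|\ \text{there exists a subsequence }(\mu_n)\text{ of }(\lambda_n)\text{ such that } a=\limsup_{n\to+\infty}\Big|\frac{\mu_{n+1}}{\mu_n}\Big|\Big\}.$$ *)

theory Defs
  imports "HOL-Analysis.Analysis"
begin

definition entire :: "(complex \<Rightarrow> complex) set" where
  "entire = {f. f holomorphic_on UNIV}"

text \<open>
  The topology of local uniform convergence on the space of entire functions: the basic
  neighbourhoods of \<open>f\<close> consist of the entire functions that are uniformly \<open>e\<close>-close to \<open>f\<close> on a
  compact set \<open>K\<close>. Convergence in it is uniform convergence on compact sets; see
  \<open>limitin_entire_topology\<close>.
\<close>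

definition entire_open :: "(complex \<Rightarrow> complex) set \<Rightarrow> bool" where
  "entire_open U \<longleftrightarrow> U \<subseteq> entire \<and>
     (\<forall>f\<in>U. \<exists>K e. compact K \<and> e > 0 \<and>
        (\<forall>g\<in>entire. (\<forall>z\<in>K. dist (g z) (f z) < e) \<longrightarrow> g \<in> U))"

definition entire_topology :: "(complex \<Rightarrow> complex) topology" where
  "entire_topology = topology entire_open"

lemma istopology_entire_open: "istopology entire_open"
  unfolding istopology_def
proof (intro conjI allI impI)
  fix S T assume S: "entire_open S" and T: "entire_open T"
  show "entire_open (S \<inter> T)"
    unfolding entire_open_def
  proof (intro conjI ballI)
    show "S \<inter> T \<subseteq> entire" using S by (auto simp: entire_open_def)
    fix f assume f: "f \<in> S \<inter> T"
    obtain K e where 1: "compact K" "e > 0"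
      "\<forall>g\<in>entire. (\<forall>z\<in>K. dist (g z) (f z) < e) \<longrightarrow> g \<in> S"
      using S f unfolding entire_open_def by blast
    obtain L d where 2: "compact L" "d > 0"
      "\<forall>g\<in>entire. (\<forall>z\<in>L. dist (g z) (f z) < d) \<longrightarrow> g \<in> T"
      using T f unfolding entire_open_def by blast
    show "\<exists>K e. compact K \<and> e > 0 \<and>
        (\<forall>g\<in>entire. (\<forall>z\<in>K. dist (g z) (f z) < e) \<longrightarrow> g \<in> S \<inter> T)"
      using 1 2 by (intro exI[of _ "K \<union> L"] exI[of _ "min e d"]) auto
  qed
next
  fix \<K> assume *: "\<forall>K\<in>\<K>. entire_open K"
  show "entire_open (\<Union>\<K>)"
    unfolding entire_open_def
  proof (intro conjI ballI)
    show "\<Union>\<K> \<subseteq> entire" using * by (auto simp: entire_open_def)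
    fix f assume "f \<in> \<Union>\<K>"
    then obtain U where U: "U \<in> \<K>" "f \<in> U" by blast
    then obtain K e where "compact K" "e > 0"
      "\<forall>g\<in>entire. (\<forall>z\<in>K. dist (g z) (f z) < e) \<longrightarrow> g \<in> U"
      using * unfolding entire_open_def by meson
    then show "\<exists>K e. compact K \<and> e > 0 \<and>
        (\<forall>g\<in>entire. (\<forall>z\<in>K. dist (g z) (f z) < e) \<longrightarrow> g \<in> \<Union>\<K>)"
      using U by blast
  qed
qed

lemma openin_entire_topology: "openin entire_topology = entire_open"
  by (simp add: entire_topology_def istopology_entire_open topology_inverse')

lemma topspace_entire_topology [simp]: "topspace entire_topology = entire"
proof
  have "entire_open entire"
    unfolding entire_open_def by (auto intro!: exI[of _ "{}"] exI[of _ "1::real"])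
  then show "entire \<subseteq> topspace entire_topology"
    by (metis openin_entire_topology openin_subset)
  show "topspace entire_topology \<subseteq> entire"
    using openin_topspace[of entire_topology]
    unfolding openin_entire_topology entire_open_def by blast
qed

lemma openin_entire_basic:
  assumes "f \<in> entire" "compact K"
  shows "openin entire_topology {g \<in> entire. \<forall>z\<in>K. dist (g z) (f z) < e}"
  unfolding openin_entire_topology entire_open_def
proof (intro conjI ballI)
  fix g assume g: "g \<in> {g \<in> entire. \<forall>z\<in>K. dist (g z) (f z) < e}"
  have cont: "continuous_on K (\<lambda>z. dist (g z) (f z))"
    using g assms unfolding entire_def
    by (auto intro!: continuous_intros
        dest!: holomorphic_on_imp_continuous_on intro: continuous_on_subset)
  obtain m where m: "m < e" "\<forall>z\<in>K. dist (g z) (f z) \<le> m"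
  proof (cases "K = {}")
    case True
    then show ?thesis using that[of "e - 1"] by simp
  next
    case False
    with continuous_attains_sup[OF \<open>compact K\<close> False cont] g that show ?thesis
      by blast
  qed
  have "h \<in> {g \<in> entire. \<forall>z\<in>K. dist (g z) (f z) < e}"
    if "h \<in> entire" "\<forall>z\<in>K. dist (h z) (g z) < e - m" for h
  proof -
    have "dist (h z) (f z) < e" if "z \<in> K" for z
      using dist_triangle[of "h z" "f z" "g z"] m(2) \<open>\<forall>z\<in>K. dist (h z) (g z) < e - m\<close> that
      by fastforce
    then show ?thesis using that by simp
  qed
  then show "\<exists>L d. compact L \<and> d > 0 \<and>
      (\<forall>h\<in>entire. (\<forall>z\<in>L. dist (h z) (g z) < d) \<longrightarrow>
        h \<in> {g \<in> entire. \<forall>z\<in>K. dist (g z) (f z) < e})"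
    using m \<open>compact K\<close> by (intro exI[of _ K] exI[of _ "e - m"]) auto
qed auto

lemma limitin_entire_topology:
  "limitin entire_topology F f G \<longleftrightarrow>
     f \<in> entire \<and> (\<forall>\<^sub>F n in G. F n \<in> entire) \<and> (\<forall>K. compact K \<longrightarrow> uniform_limit K F f G)"
proof (intro iffI conjI allI impI)
  assume L: "limitin entire_topology F f G"
  show f: "f \<in> entire" using L by (simp add: limitin_def)
  show "\<forall>\<^sub>F n in G. F n \<in> entire"
    using L openin_topspace[of entire_topology] by (auto simp: limitin_def)
  fix K :: "complex set" assume K: "compact K"
  show "uniform_limit K F f G"
  proof (rule uniform_limitI)
    fix e :: real assume "e > 0"
    with f have "\<forall>\<^sub>F n in G. F n \<in> {g \<in> entire. \<forall>z\<in>K. dist (g z) (f z) < e}"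
      using L[unfolded limitin_def, THEN conjunct2, rule_format,
          OF conjI[OF openin_entire_basic[OF f K, of e]]] \<open>e > 0\<close> by simp
    then show "\<forall>\<^sub>F n in G. \<forall>z\<in>K. dist (F n z) (f z) < e"
      by (rule eventually_mono) auto
  qed
next
  assume R: "f \<in> entire \<and> (\<forall>\<^sub>F n in G. F n \<in> entire) \<and>
    (\<forall>K. compact K \<longrightarrow> uniform_limit K F f G)"
  show "limitin entire_topology F f G"
    unfolding limitin_def
  proof (intro conjI allI impI)
    show "f \<in> topspace entire_topology" using R by simp
    fix U assume "openin entire_topology U \<and> f \<in> U"
    then obtain K e where Ke: "compact K" "e > 0"
      "\<forall>g\<in>entire. (\<forall>z\<in>K. dist (g z) (f z) < e) \<longrightarrow> g \<in> U"
      unfolding openin_entire_topology entire_open_def by blast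
    then have "\<forall>\<^sub>F n in G. \<forall>z\<in>K. dist (F n z) (f z) < e"
      using R uniform_limitD by blast
    with R have "\<forall>\<^sub>F n in G. F n \<in> entire \<and> (\<forall>z\<in>K. dist (F n z) (f z) < e)"
      by (simp add: eventually_conj)
    then show "\<forall>\<^sub>F n in G. F n \<in> U"
      by (rule eventually_mono) (use Ke in blast)
  qed
qed

definition translation :: "complex \<Rightarrow> (complex \<Rightarrow> complex) \<Rightarrow> (complex \<Rightarrow> complex)" where
  "translation b f = (\<lambda>z. f (z + b))"

lemma translation_entire: "f \<in> entire \<Longrightarrow> translation b f \<in> entire"
proof -
  assume "f \<in> entire"
  then have "f \<circ> (\<lambda>z. z + b) holomorphic_on UNIV"
    unfolding entire_def
    by (intro holomorphic_on_compose_gen[where t = UNIV]) (auto intro!: holomorphic_intros)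
  then show "translation b f \<in> entire"
    by (simp add: entire_def translation_def o_def)
qed

lemma continuous_map_translation:
  "continuous_map entire_topology entire_topology (translation b)"
  unfolding continuous_map_def openin_entire_topology topspace_entire_topology
proof (intro conjI allI impI)
  show "translation b \<in> entire \<rightarrow> entire"
    by (simp add: translation_entire)
  fix U assume U: "entire_open U"
  show "entire_open {f \<in> entire. translation b f \<in> U}"
    unfolding entire_open_def
  proof (intro conjI ballI)
    fix f assume "f \<in> {f \<in> entire. translation b f \<in> U}"
    then obtain K e where Ke: "compact K" "e > 0"
      "\<forall>g\<in>entire. (\<forall>z\<in>K. dist (g z) (translation b f z) < e) \<longrightarrow> g \<in> U"
      using U unfolding entire_open_def by blast
    have "compact ((\<lambda>z. z + b) ` K)"
      using Ke(1) by (intro compact_continuous_image continuous_intros)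
    moreover have "translation b g \<in> U"
      if "g \<in> entire" "\<forall>z\<in>(\<lambda>z. z + b) ` K. dist (g z) (f z) < e" for g
      using that Ke(3) translation_entire[of g b] by (auto simp: translation_def)
    ultimately show "\<exists>K e. compact K \<and> e > 0 \<and>
        (\<forall>g\<in>entire. (\<forall>z\<in>K. dist (g z) (f z) < e) \<longrightarrow>
          g \<in> {f \<in> entire. translation b f \<in> U})"
      using Ke(2) by blast
  qed auto
qed

definition HC :: "(nat \<Rightarrow> (complex \<Rightarrow> complex) \<Rightarrow> (complex \<Rightarrow> complex)) \<Rightarrow> (complex \<Rightarrow> complex) set" where
  "HC T = {f \<in> entire. entire_topology closure_of {T n f | n. True} = entire}"

text \<open>
  Sequences are indexed from 0. All the limits superior here are of nonnegative quantities, so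
  the exclusion of \<open>-\<infinity>\<close> only records the range of \<open>a\<close>.
\<close>

definition ratio_index :: "(nat \<Rightarrow> complex) \<Rightarrow> ereal" where
  "ratio_index \<mu> = Inf {a. a \<noteq> -\<infinity> \<and>
     (\<exists>r :: nat \<Rightarrow> nat. strict_mono r \<and>
        a = limsup (\<lambda>n. ereal (norm (\<mu> (r (Suc n)) / \<mu> (r n)))))}"

end

theory Submission
  imports Defs "HOL-Complex_Analysis.Complex_Analysis"
    "HOL-Computational_Algebra.Fundamental_Theorem_Algebra"
begin

text \<open>
  Let \<open>U h k \<epsilon> S\<close> (formally \<open>orbit_approximators \<Lambda> S h k \<epsilon>\<close>) be the set of entire \<open>f\<close> such that
  for each \<open>a \<in> S\<close> some translate \<open>f (z + \<Lambda> n * a)\<close> is \<open>\<epsilon>\<close>-close to \<open>h\<close> on the disc of radius \<open>k\<close>. The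
  common hypercyclic functions form the intersection of these sets when \<open>h\<close> runs through a countable
  dense set of polynomials, \<open>k\<close> and \<open>1 / \<epsilon>\<close> through natural numbers, and, for each such triple, \<open>S\<close>
  through countably many compact sets that cover the punctured plane. For compact \<open>S\<close> the set
  \<open>U h k \<epsilon> S\<close> is open (\<open>openin_orbit_approximators\<close>), so by Baire it remains to choose the sets \<open>S\<close> in
  such a way that \<open>U h k \<epsilon> S\<close> is dense. The freedom that makes this easy is that \<open>S\<close> may depend on \<open>h\<close>,
  \<open>k\<close> and \<open>\<epsilon>\<close>: annuli \<open>\<rho> \<le> norm a \<le> t * \<rho>\<close> suffice, with \<open>t > 1\<close> as close to 1 as needed.

  By uniform continuity of \<open>h\<close> there is \<open>\<delta>\<close> such that one parameter \<open>b\<close> with \<open>f (z + \<Lambda> n * b)\<close> close to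
  \<open>h\<close> on a slightly larger disc serves all \<open>a\<close> with \<open>norm (\<Lambda> n * (a - b)) \<le> \<delta>\<close>. Finitely many such
  conditions, together with closeness to a given function on a large disc, can be met by one entire
  function as soon as the discs of radius \<open>k + 1\<close> about the points \<open>\<Lambda> n * b\<close> are disjoint from each
  other and from the large disc; this is Runge's theorem for a union of disjoint discs
  (\<open>simultaneous_approximation_on_discs\<close>).

  So the annulus has to be covered by discs of radius \<open>\<delta> / norm (\<Lambda> n)\<close> about finitely many points \<open>b\<close>,
  each with its own \<open>n\<close>, such that the points \<open>\<Lambda> n * b\<close> have mutual distances greater than
  \<open>r = 2 * (k + 1)\<close>. One \<open>n\<close> covers only a proportion of about \<open>(\<delta> / r)\<^sup>2\<close> of the annulus. But
  \<open>ratio_index \<Lambda> = 1\<close> provides, for each \<open>q > 1\<close> and each large \<open>x\<close>, a term with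
  \<open>x \<le> norm (\<Lambda> m) \<le> q * x\<close>, so that any number \<open>M\<close> of terms can be found whose moduli lie between
  \<open>x\<close> and \<open>2 * x\<close> and increase by a factor at least \<open>t\<^sup>2\<close>, where \<open>t\<close> depends on \<open>M\<close> only. These
  terms map the annulus into annuli that are far from each other when \<open>x\<close> is large. Hence a grid with
  spacing proportional to \<open>\<delta> / x\<close> is coloured with \<open>M = L\<^sup>2\<close> colours by the residues of its coordinates
  modulo \<open>L\<close>, and each colour uses its own term: points of different colours are separated by the
  choice of \<open>t\<close>, points of equal colour by the choice of \<open>L\<close>
  (\<open>annulus_cover_with_separated_images\<close>).
\<close>

section \<open>Uniform approximation by entire functions on compact sets\<close>

lemma entireD: "f \<in> entire \<Longrightarrow> f holomorphic_on A"
  unfolding entire_def using holomorphic_on_subset by blast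

lemma entire_continuous_on: "f \<in> entire \<Longrightarrow> continuous_on A f"
  using entireD holomorphic_on_imp_continuous_on by blast

definition entire_approximable :: "complex set \<Rightarrow> (complex \<Rightarrow> complex) \<Rightarrow> bool" where
  "entire_approximable E g \<longleftrightarrow> (\<forall>\<epsilon>>0. \<exists>f\<in>entire. \<forall>z\<in>E. dist (f z) (g z) < \<epsilon>)"

lemma entire_approximable_entire: "g \<in> entire \<Longrightarrow> entire_approximable E g"
  unfolding entire_approximable_def by (intro allI impI bexI[of _ g]) auto

lemma entire_approximable_cong:
  assumes "entire_approximable E g" "\<And>z. z \<in> E \<Longrightarrow> g z = h z"
  shows "entire_approximable E h"
  using assms unfolding entire_approximable_def by simp

lemma entire_approximable_limit:
  assumes "\<And>\<epsilon>. \<epsilon> > 0 \<Longrightarrow> \<exists>h. entire_approximable E h \<and> (\<forall>z\<in>E. dist (h z) (g z) < \<epsilon>)"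
  shows "entire_approximable E g"
  unfolding entire_approximable_def
proof (intro allI impI)
  fix \<epsilon> :: real assume "\<epsilon> > 0"
  then obtain h where h: "entire_approximable E h" "\<forall>z\<in>E. dist (h z) (g z) < \<epsilon>/2"
    using assms[of "\<epsilon>/2"] by auto
  obtain f where f: "f \<in> entire" "\<forall>z\<in>E. dist (f z) (h z) < \<epsilon>/2"
    using h(1) \<open>\<epsilon> > 0\<close> unfolding entire_approximable_def by (meson half_gt_zero)
  have "dist (f z) (g z) < \<epsilon>" if "z \<in> E" for z
    using dist_triangle_half_r[of "h z" "f z" \<epsilon> "g z"] f h that by (simp add: dist_commute)
  with f show "\<exists>f\<in>entire. \<forall>z\<in>E. dist (f z) (g z) < \<epsilon>" by blast
qed

lemma entire_approximable_add:
  assumes "entire_approximable E g" "entire_approximable E h"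
  shows "entire_approximable E (\<lambda>z. g z + h z)"
  unfolding entire_approximable_def
proof (intro allI impI)
  fix \<epsilon> :: real assume "\<epsilon> > 0"
  then obtain f k where f: "f \<in> entire" "\<forall>z\<in>E. dist (f z) (g z) < \<epsilon>/2"
    and k: "k \<in> entire" "\<forall>z\<in>E. dist (k z) (h z) < \<epsilon>/2"
    using assms unfolding entire_approximable_def by (meson half_gt_zero)
  have "dist (f z + k z) (g z + h z) < \<epsilon>" if "z \<in> E" for z
    using dist_triangle_add[of "f z" "k z" "g z" "h z"] f k that by fastforce
  moreover have "(\<lambda>z. f z + k z) \<in> entire"
    using f k unfolding entire_def by (auto intro: holomorphic_intros)
  ultimately show "\<exists>f\<in>entire. \<forall>z\<in>E. dist (f z) (g z + h z) < \<epsilon>"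
    by (intro bexI[of _ "\<lambda>z. f z + k z"]) auto
qed

lemma entire_approximable_bounded:
  assumes "compact E" "entire_approximable E g"
  obtains M where "M > 0" "\<And>z. z \<in> E \<Longrightarrow> norm (g z) \<le> M"
proof -
  obtain f where f: "f \<in> entire" "\<forall>z\<in>E. dist (f z) (g z) < 1"
    using assms(2) unfolding entire_approximable_def by (meson zero_less_one)
  have "bounded (f ` E)"
    using assms(1) f(1) entire_continuous_on compact_continuous_image compact_imp_bounded by blast
  then obtain B where B: "B > 0" "\<And>z. z \<in> E \<Longrightarrow> norm (f z) \<le> B"
    unfolding bounded_pos by auto
  have "norm (g z) \<le> B + 1" if "z \<in> E" for z
  proof -
    have "norm (g z) \<le> norm (f z) + dist (f z) (g z)"
      by (metis dist_commute dist_norm norm_triangle_sub)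
    then show ?thesis using B(2)[OF that] f(2) that by force
  qed
  then show ?thesis using that[of "B + 1"] B by auto
qed

lemma entire_approximable_mult:
  assumes "compact E" "entire_approximable E g" "entire_approximable E h"
  shows "entire_approximable E (\<lambda>z. g z * h z)"
  unfolding entire_approximable_def
proof (intro allI impI)
  fix \<epsilon> :: real assume \<epsilon>: "\<epsilon> > 0"
  obtain M where M: "M > 0" "\<And>z. z \<in> E \<Longrightarrow> norm (g z) \<le> M"
    using entire_approximable_bounded assms by metis
  obtain N where N: "N > 0" "\<And>z. z \<in> E \<Longrightarrow> norm (h z) \<le> N"
    using entire_approximable_bounded assms by metis
  define \<delta> where "\<delta> = min 1 (\<epsilon> / (M + N + 1))"
  have MN: "M + N + 1 > 0" using M(1) N(1) by simp
  have "\<delta> \<le> \<epsilon> / (M + N + 1)" by (simp add: \<delta>_def)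
  then have \<delta>: "\<delta> > 0" "\<delta> \<le> 1" "\<delta> * (M + N + 1) \<le> \<epsilon>"
    using \<epsilon> MN by (simp_all only: pos_le_divide_eq) (auto simp: \<delta>_def)
  obtain f where f: "f \<in> entire" "\<forall>z\<in>E. dist (f z) (g z) < \<delta>"
    using assms(2) \<delta>(1) unfolding entire_approximable_def by meson
  obtain k where k: "k \<in> entire" "\<forall>z\<in>E. dist (k z) (h z) < \<delta>"
    using assms(3) \<delta>(1) unfolding entire_approximable_def by meson
  have "dist (f z * k z) (g z * h z) < \<epsilon>" if z: "z \<in> E" for z
  proof -
    have d: "norm (f z - g z) < \<delta>" "norm (k z - h z) < \<delta>"
      using f k z by (auto simp: dist_norm)
    have eq: "f z * k z - g z * h z = (f z - g z) * (k z - h z) + (f z - g z) * h z + g z * (k z - h z)"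
      by (simp add: algebra_simps)
    have "norm (f z * k z - g z * h z)
        \<le> norm (f z - g z) * norm (k z - h z) + norm (f z - g z) * norm (h z) + norm (g z) * norm (k z - h z)"
      unfolding eq using norm_triangle_ineq[of "(f z - g z) * (k z - h z) + (f z - g z) * h z" "g z * (k z - h z)"]
        norm_triangle_ineq[of "(f z - g z) * (k z - h z)" "(f z - g z) * h z"]
      by (simp only: norm_mult)
    also have "\<dots> < \<delta> * 1 + \<delta> * N + M * \<delta>"
    proof (intro add_less_le_mono mult_mono mult_strict_mono)
    qed (use d \<delta> M(1) M(2)[OF z] N(1) N(2)[OF z] in auto)
    also have "\<dots> \<le> \<epsilon>" using \<delta>(3) by (simp add: algebra_simps)
    finally show ?thesis by (simp add: dist_norm)
  qed
  moreover have "(\<lambda>z. f z * k z) \<in> entire"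
    using f k unfolding entire_def by (auto intro: holomorphic_intros)
  ultimately show "\<exists>f\<in>entire. \<forall>z\<in>E. dist (f z) (g z * h z) < \<epsilon>"
    by (intro bexI[of _ "\<lambda>z. f z * k z"]) auto
qed

lemma entire_approximable_const: "entire_approximable E (\<lambda>z. c)"
  by (rule entire_approximable_entire) (simp add: entire_def)

text \<open>
  The approximants are the partial sums of the geometric series. This is the only way in which
  quotients enter; it serves both for poles far away and for moving a pole.
\<close>

lemma entire_approximable_geometric:
  assumes E: "compact E" and u: "entire_approximable E u"
    and q: "q < 1" "\<And>z. z \<in> E \<Longrightarrow> norm (u z) \<le> q"
  shows "entire_approximable E (\<lambda>z. 1 / (1 - u z))"
proof (cases "E = {}")
  case True
  then show ?thesis by (intro entire_approximable_cong[OF entire_approximable_const[of E 0]]) auto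
next
  case False
  then have q0: "0 \<le> q" using q(2) norm_ge_zero order_trans by blast
  have partial: "entire_approximable E (\<lambda>z. \<Sum>i<n. u z ^ i)" for n
  proof (induction n)
    case 0
    show ?case by (simp add: entire_approximable_const)
  next
    case (Suc n)
    have "entire_approximable E (\<lambda>z. u z ^ n)"
      by (induction n) (simp_all add: entire_approximable_const entire_approximable_mult[OF E u])
    with Suc show ?case by (simp add: entire_approximable_add)
  qed
  show ?thesis
  proof (rule entire_approximable_limit)
    fix \<epsilon> :: real assume "\<epsilon> > 0"
    then have "\<epsilon> * (1 - q) > 0" using q(1) by simp
    then obtain n where n: "q ^ n < \<epsilon> * (1 - q)"
      using real_arch_pow_inv[of "\<epsilon> * (1 - q)" q] q(1) by blast
    have "dist (\<Sum>i<n. u z ^ i) (1 / (1 - u z)) < \<epsilon>" if z: "z \<in> E" for z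
    proof -
      have u1: "u z \<noteq> 1" using q(1) q(2)[OF z] by auto
      have "norm (1 - u z) \<ge> 1 - q"
        using norm_triangle_ineq2[of 1 "u z"] q(2)[OF z] by simp
      have "dist (\<Sum>i<n. u z ^ i) (1 / (1 - u z)) = norm (u z ^ n / (1 - u z))"
        using u1 by (simp add: dist_norm sum_gp_strict diff_divide_distrib[symmetric])
      also have "\<dots> \<le> q ^ n / (1 - q)"
        unfolding norm_divide norm_power
        by (intro frac_le power_mono) (use q q0 q(2)[OF z] \<open>norm (1 - u z) \<ge> 1 - q\<close> in auto)
      also have "\<dots> < \<epsilon>" using n q(1) by (simp add: field_simps)
      finally show ?thesis .
    qed
    then show "\<exists>h. entire_approximable E h \<and> (\<forall>z\<in>E. dist (h z) (1 / (1 - u z)) < \<epsilon>)"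
      by (intro exI[of _ "\<lambda>z. \<Sum>i<n. u z ^ i"] conjI partial) auto
  qed
qed

text \<open>
  Pole pushing: \<open>1 / (z - w')\<close> is \<open>1 / (z - w)\<close> times a geometric series in \<open>(w' - w) / (z - w)\<close>.
  The factor 2 makes that series converge uniformly.
\<close>

lemma entire_approximable_move_pole:
  assumes E: "compact E" and w: "w \<notin> E" "entire_approximable E (\<lambda>z. 1 / (z - w))"
    and near: "\<And>z. z \<in> E \<Longrightarrow> 2 * norm (w' - w) \<le> norm (z - w)"
  shows "entire_approximable E (\<lambda>z. 1 / (z - w'))"
proof -
  define u where "u z = (w' - w) * (1 / (z - w))" for z
  have u: "entire_approximable E u"
    unfolding u_def by (intro entire_approximable_mult entire_approximable_const E w(2))
  have "norm (u z) \<le> 1/2" if "z \<in> E" for z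
  proof -
    have "z \<noteq> w" using w that by auto
    then show ?thesis using near[OF that] by (simp add: u_def norm_divide norm_mult divide_simps)
  qed
  then have "entire_approximable E (\<lambda>z. 1 / (z - w) * (1 / (1 - u z)))"
    by (intro entire_approximable_mult entire_approximable_geometric[where q = "1/2"] E w(2) u) auto
  then show ?thesis
  proof (rule entire_approximable_cong)
    fix z assume "z \<in> E"
    then have "z \<noteq> w" using w by auto
    then have "(z - w) * (1 - u z) = z - w'" by (simp add: u_def field_simps)
    then show "1 / (z - w) * (1 / (1 - u z)) = 1 / (z - w')" by (metis mult_1 times_divide_times_eq)
  qed
qed

text \<open>
  For a pole of large modulus the claim is a geometric series in \<open>z / a\<close>. Since a pole can be moved
  within a distance that is bounded below locally, the property spreads over the connected
  complement.
\<close>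

lemma entire_approximable_simple_pole:
  assumes E: "compact E" and conn: "connected (- E)" and w: "w \<notin> E"
  shows "entire_approximable E (\<lambda>z. 1 / (z - w))"
proof (cases "E = {}")
  case True
  then show ?thesis by (intro entire_approximable_cong[OF entire_approximable_const[of E 0]]) auto
next
  case False
  obtain B where B: "B > 0" "\<And>z. z \<in> E \<Longrightarrow> norm z \<le> B"
    using compact_imp_bounded[OF E] unfolding bounded_pos by auto
  define a where "a = complex_of_real (2 * B)"
  have na: "norm a = 2 * B" using B(1) by (simp add: a_def)
  have a: "a \<in> - E" using B(1) B(2)[of a] na by auto
  have a0: "a \<noteq> 0" using na B(1) by auto
  show ?thesis
  proof (rule connected_induction_simple[OF conn, of a w])
    show "a \<in> - E" "w \<in> - E" using a w by auto
    have scaled: "entire_approximable E (\<lambda>z. 1/a * z)"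
      by (rule entire_approximable_entire) (auto intro!: holomorphic_intros simp: a0 entire_def)
    have "entire_approximable E (\<lambda>z. - 1/a * (1 / (1 - 1/a * z)))"
    proof (rule entire_approximable_mult[OF E entire_approximable_const
          entire_approximable_geometric[OF E scaled, where q = "1/2"]])
      show "norm (1/a * z) \<le> 1/2" if "z \<in> E" for z
        using B(2)[OF that] na B(1) by (simp add: norm_divide divide_simps)
    qed simp
    then show "entire_approximable E (\<lambda>z. 1 / (z - a))"
    proof (rule entire_approximable_cong)
      fix z assume "z \<in> E"
      then have "z \<noteq> a" using a by auto
      then show "- 1/a * (1 / (1 - 1/a * z)) = 1 / (z - a)" using a0 by (simp add: divide_simps) 
    qed
  next
    fix b assume b: "b \<in> - E"
    define d where "d = infdist b E"
    have d: "d > 0"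
      unfolding d_def using b by (intro infdist_pos_not_in_closed compact_imp_closed E False) simp
    have far: "d \<le> dist b z" if "z \<in> E" for z
      unfolding d_def using that by (rule infdist_le)
    \<comment> \<open>Two points of this ball are at distance less than \<open>2 * d/5\<close>, and at least \<open>4 * d/5\<close> away from
    \<open>E\<close>: just what moving a pole from one to the other requires.\<close>
    have T: "ball b (d/5) \<subseteq> - E" using far d by force
    show "\<exists>T. openin (top_of_set (- E)) T \<and> b \<in> T \<and>
        (\<forall>x\<in>T. \<forall>y\<in>T. entire_approximable E (\<lambda>z. 1 / (z - x)) \<longrightarrow> entire_approximable E (\<lambda>z. 1 / (z - y)))"
    proof (intro exI conjI ballI impI)
      show "openin (top_of_set (- E)) (ball b (d/5))" by (intro open_subset T open_ball)
      show "b \<in> ball b (d/5)" using d by simp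
      fix x y assume xy: "x \<in> ball b (d/5)" "y \<in> ball b (d/5)"
        and x: "entire_approximable E (\<lambda>z. 1 / (z - x))"
      show "entire_approximable E (\<lambda>z. 1 / (z - y))"
      proof (rule entire_approximable_move_pole[OF E _ x])
        show "x \<notin> E" using T xy by auto
        fix z assume z: "z \<in> E"
        have "dist y x \<le> dist b y + dist b x" by (metis dist_commute dist_triangle)
        moreover have "dist b z \<le> dist b x + dist z x" by (metis dist_commute dist_triangle)
        ultimately show "2 * norm (y - x) \<le> norm (z - x)"
          using far[OF z] xy unfolding dist_norm[symmetric] by simp
      qed
    qed
  qed
qed

lemma entire_approximable_inverse_poly:
  fixes p :: "complex poly"
  assumes E: "compact E" and conn: "connected (- E)" and p: "p \<noteq> 0" "\<And>z. z \<in> E \<Longrightarrow> poly p z \<noteq> 0"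
  shows "entire_approximable E (\<lambda>z. 1 / poly p z)"
proof -
  obtain A where A: "p = smult (lead_coeff p) (\<Prod>x\<in>#A. [:-x, 1:])"
    using alg_closed_imp_factorization[OF p(1)] by blast
  have eq: "poly p z = lead_coeff p * (\<Prod>x\<in>#A. z - x)" for z
    by (subst A) (simp add: poly_prod_mset)
  have "entire_approximable E (\<lambda>z. 1 / (\<Prod>x\<in>#B. z - x))" if "set_mset B \<subseteq> - E" for B
    using that
  proof (induction B)
    case empty
    show ?case by (simp add: entire_approximable_const)
  next
    case (add x B)
    then show ?case
      using entire_approximable_mult[OF E entire_approximable_simple_pole[OF E conn, of x], of "\<lambda>z. 1 / (\<Prod>x\<in>#B. z - x)"]
      by simp
  qed
  moreover have "set_mset A \<subseteq> - E"
  proof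
    fix x assume "x \<in># A"
    then have "poly p x = 0" by (simp add: eq)
    then show "x \<in> - E" using p(2) by auto
  qed
  ultimately have "entire_approximable E (\<lambda>z. 1 / lead_coeff p * (1 / (\<Prod>x\<in>#A. z - x)))"
    by (intro entire_approximable_mult entire_approximable_const E) 
  then show ?thesis unfolding eq by simp
qed

text \<open>
  The rational function \<open>1 / (1 - v\<^sup>N)\<close> with \<open>v = (z - c) / \<rho>\<close> and \<open>r < \<rho> < s\<close> has its poles on the
  circle of radius \<open>\<rho>\<close>, which avoids \<open>E\<close>. For large \<open>N\<close> it is close to 1 inside and close to 0 outside.
\<close>

lemma entire_approximates_disc_indicator:
  assumes E: "compact E" and conn: "connected (- E)" and rs: "0 < r" "r < s"
    and sep: "\<And>z. z \<in> E \<Longrightarrow> norm (z - c) \<le> r \<or> s \<le> norm (z - c)" and \<epsilon>: "\<epsilon> > 0"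
  obtains f where "f \<in> entire"
    "\<And>z. z \<in> E \<Longrightarrow> norm (z - c) \<le> r \<Longrightarrow> norm (f z - 1) < \<epsilon>"
    "\<And>z. z \<in> E \<Longrightarrow> s \<le> norm (z - c) \<Longrightarrow> norm (f z) < \<epsilon>"
proof -
  define \<rho> where "\<rho> = (r + s) / 2"
  have \<rho>: "r < \<rho>" "\<rho> < s" "0 < \<rho>" using rs by (auto simp: \<rho>_def)
  define q where "q = max (r / \<rho>) (\<rho> / s)"
  have q: "q < 1" "0 < q" "r / \<rho> \<le> q" "\<rho> / s \<le> q" using \<rho> rs by (auto simp: q_def less_max_iff_disj)
  define b where "b = min (1/2) (\<epsilon> / 4)"
  obtain N where N: "q ^ N < b"
    using real_arch_pow_inv[of b q] q(1) \<epsilon> b_def by auto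
  define Q where "Q = q ^ N"
  have Q: "0 < Q" "Q < 1/2" "Q < \<epsilon> / 4" using N q(2) by (auto simp: Q_def b_def)
  define v where "v z = (z - c) / of_real \<rho>" for z
  define p where "p = 1 - [:- c / of_real \<rho>, 1 / of_real \<rho>:] ^ N"
  have poly_p: "poly p z = 1 - v z ^ N" for z
    by (simp add: p_def v_def diff_divide_distrib)
  have near: "norm (v z ^ N) \<le> Q" if "norm (z - c) \<le> r" for z
  proof -
    have "norm (v z) \<le> r / \<rho>"
      using that \<rho>(3) by (simp add: v_def norm_divide divide_right_mono)
    also have "\<dots> \<le> q" by (fact q(3))
    finally show ?thesis unfolding Q_def norm_power by (intro power_mono) auto
  qed
  have far: "1 / Q \<le> norm (v z ^ N)" if "s \<le> norm (z - c)" for z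
  proof -
    have "1 / q \<le> s / \<rho>" using q(2,4) \<rho> rs by (simp add: field_simps)
    also have "\<dots> \<le> norm (v z)"
      using that \<rho>(3) by (simp add: v_def norm_divide divide_right_mono)
    finally have "(1 / q) ^ N \<le> norm (v z) ^ N" using q(2) by (intro power_mono) auto
    then show ?thesis by (simp add: Q_def norm_power power_divide)
  qed
  have near': "norm (1 / poly p z - 1) \<le> \<epsilon> / 2 \<and> poly p z \<noteq> 0" if "norm (z - c) \<le> r" for z
  proof -
    have n: "norm (v z ^ N) \<le> Q" using near that by blast
    then have ne: "v z ^ N \<noteq> 1" using Q by auto
    have d: "1/2 \<le> norm (1 - v z ^ N)"
      using norm_triangle_ineq2[of 1 "v z ^ N"] n Q by simp
    have "1 / poly p z - 1 = v z ^ N / (1 - v z ^ N)" unfolding poly_p using ne by (simp add: field_simps)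
    then have "norm (1 / poly p z - 1) = norm (v z ^ N) / norm (1 - v z ^ N)"
      by (simp add: norm_divide)
    also have "\<dots> \<le> Q / (1/2)" by (intro frac_le n d) (use Q in auto)
    finally show ?thesis using Q ne poly_p by auto
  qed
  have far': "norm (1 / poly p z) \<le> \<epsilon> / 2 \<and> poly p z \<noteq> 0" if "s \<le> norm (z - c)" for z
  proof -
    have n: "1 / Q \<le> norm (v z ^ N)" using far that by blast
    have "1 / (2 * Q) \<le> 1 / Q - 1" using Q by (simp add: field_simps)
    also have "\<dots> \<le> norm (1 - v z ^ N)"
      using norm_triangle_ineq2[of "v z ^ N" 1] n by (simp add: norm_minus_commute)
    finally have d: "1 / (2 * Q) \<le> norm (1 - v z ^ N)" .
    have "norm (1 / poly p z) = 1 / norm (1 - v z ^ N)" unfolding poly_p by (simp add: norm_divide)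
    also have "\<dots> \<le> 1 / (1 / (2 * Q))" by (intro frac_le d) (use Q in auto)
    finally have 1: "norm (1 / poly p z) \<le> \<epsilon> / 2" using Q by simp
    have "0 < 1 / (2 * Q)" using Q by simp
    with d have "1 - v z ^ N \<noteq> 0" by auto
    with 1 show ?thesis by (simp add: poly_p)
  qed
  have nz: "poly p z \<noteq> 0" if "z \<in> E" for z
    using sep[OF that] near' far' by blast
  have "p \<noteq> 0" using near'[of c] rs by auto
  then have "entire_approximable E (\<lambda>z. 1 / poly p z)"
    by (rule entire_approximable_inverse_poly[OF E conn _ nz])
  then obtain f where f: "f \<in> entire" "\<forall>z\<in>E. dist (f z) (1 / poly p z) < \<epsilon> / 2"
    using \<epsilon> unfolding entire_approximable_def by (meson half_gt_zero)
  show ?thesis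
  proof (rule that[OF f(1)])
    fix z assume z: "z \<in> E"
    have fz: "norm (f z - 1 / poly p z) < \<epsilon> / 2" using f(2) z by (simp add: dist_norm)
    show "norm (f z - 1) < \<epsilon>" if "norm (z - c) \<le> r"
      using norm_triangle_ineq[of "f z - 1 / poly p z" "1 / poly p z - 1"] fz near'[OF that] by auto
    show "norm (f z) < \<epsilon>" if "s \<le> norm (z - c)"
      using norm_triangle_ineq[of "f z - 1 / poly p z" "1 / poly p z"] fz far'[OF that] by auto
  qed
qed

section \<open>Simultaneous approximation on disjoint discs\<close>

text \<open>
  Janiszewski's theorem adds the discs one at a time.
\<close>

lemma connected_Compl_disjoint_cballs:
  fixes c :: "'i \<Rightarrow> complex"
  assumes "finite I" "disjoint_family_on (\<lambda>i. cball (c i) (r i)) I"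
  shows "connected (- (\<Union>i\<in>I. cball (c i) (r i)))"
  using assms
proof (induction I)
  case empty
  show ?case by (simp add: connected_UNIV)
next
  case (insert i I)
  let ?S = "cball (c i) (r i)" and ?T = "\<Union>j\<in>I. cball (c j) (r j)"
  have "?S \<inter> ?T = {}"
    using insert.prems insert.hyps(2) by (fastforce simp: disjoint_family_on_def)
  have "connected (- (?S \<union> ?T))"
  proof (rule Janiszewski_connected)
    show "connected (?S \<inter> ?T)" using \<open>?S \<inter> ?T = {}\<close> by simp
    show "closed ?T" using insert.hyps by (intro closed_UN) auto
    show "connected (- ?S)" by (intro connected_complement_bounded_convex) auto
    show "connected (- ?T)"
      using insert.IH insert.prems by (auto simp: disjoint_family_on_def)
  qed simp
  then show ?case by simp
qed

text \<open>
  Runge's theorem for finitely many disjoint discs. The approximant is \<open>\<Sum>i\<in>I. \<phi> i * f i\<close>, where \<open>\<phi> i\<close>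
  is entire and close to the indicator function of the \<open>i\<close>-th disc on the union of all discs.
\<close>

theorem simultaneous_approximation_on_discs:
  fixes c :: "'i \<Rightarrow> complex"
  assumes I: "finite I" and r: "\<And>i. i \<in> I \<Longrightarrow> 0 < r i"
    and sep: "\<And>i j. i \<in> I \<Longrightarrow> j \<in> I \<Longrightarrow> i \<noteq> j \<Longrightarrow> r i + r j < dist (c i) (c j)"
    and f: "\<And>i. i \<in> I \<Longrightarrow> f i \<in> entire" and \<epsilon>: "\<epsilon> > 0"
  obtains F where "F \<in> entire" "\<And>i z. i \<in> I \<Longrightarrow> z \<in> cball (c i) (r i) \<Longrightarrow> dist (F z) (f i z) < \<epsilon>"
proof -
  define E where "E = (\<Union>i\<in>I. cball (c i) (r i))"
  have E: "compact E" unfolding E_def by (intro compact_UN I) auto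
  have disj: "disjoint_family_on (\<lambda>i. cball (c i) (r i)) I"
    unfolding disjoint_family_on_def
  proof (intro ballI impI equals0I)
    fix i j x assume ij: "i \<in> I" "j \<in> I" "i \<noteq> j" and x: "x \<in> cball (c i) (r i) \<inter> cball (c j) (r j)"
    show False
      using sep[OF ij] x dist_triangle[of "c i" "c j" x] by (auto simp: dist_commute)
  qed
  have conn: "connected (- E)" unfolding E_def by (rule connected_Compl_disjoint_cballs[OF I disj])
  have "bounded (\<Union>i\<in>I. f i ` E)"
    using E I f by (intro bounded_UN) (auto intro!: compact_imp_bounded compact_continuous_image entire_continuous_on)
  then obtain B where "B > 0" "\<forall>x\<in>(\<Union>i\<in>I. f i ` E). norm x \<le> B"
    unfolding bounded_pos by auto
  then have B: "B > 0" "\<And>i z. i \<in> I \<Longrightarrow> z \<in> E \<Longrightarrow> norm (f i z) \<le> B"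
    by auto
  define \<eta> where "\<eta> = \<epsilon> / (B * (card I + 1))"
  have \<eta>: "\<eta> > 0" using \<epsilon> B(1) by (simp add: \<eta>_def)
  have "\<exists>\<phi>\<in>entire. \<forall>j\<in>I. \<forall>z\<in>cball (c j) (r j). norm (\<phi> z - (if j = i then 1 else 0)) < \<eta>"
    if i: "i \<in> I" for i
  proof -
    \<comment> \<open>No other disc comes closer to \<open>c i\<close> than \<open>s\<close>; the entry \<open>r i + 1\<close> keeps the set nonempty when there
    is only one disc.\<close>
    define s where "s = Min (insert (r i + 1) ((\<lambda>j. dist (c i) (c j) - r j) ` (I - {i})))"
    have fin: "finite (insert (r i + 1) ((\<lambda>j. dist (c i) (c j) - r j) ` (I - {i})))"
      using I by simp
    have s: "r i < s"
      unfolding s_def using fin sep[OF i] by (subst Min_gr_iff) (auto simp: less_diff_eq)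
    have far: "s \<le> norm (z - c i)" if "j \<in> I" "j \<noteq> i" "z \<in> cball (c j) (r j)" for j z
    proof -
      have "s \<le> dist (c i) (c j) - r j"
        unfolding s_def using fin that by (intro Min_le) auto
      also have "\<dots> \<le> dist (c i) z"
        using dist_triangle[of "c i" "c j" z] that(3) by (simp add: dist_commute)
      finally show ?thesis by (simp add: dist_norm norm_minus_commute)
    qed
    have near: "norm (z - c i) \<le> r i" if "z \<in> cball (c i) (r i)" for z
      using that by (simp add: dist_norm norm_minus_commute)
    obtain \<phi> where \<phi>: "\<phi> \<in> entire"
      "\<And>z. z \<in> E \<Longrightarrow> norm (z - c i) \<le> r i \<Longrightarrow> norm (\<phi> z - 1) < \<eta>"
      "\<And>z. z \<in> E \<Longrightarrow> s \<le> norm (z - c i) \<Longrightarrow> norm (\<phi> z) < \<eta>"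
    proof (rule entire_approximates_disc_indicator[OF E conn r[OF i] s _ \<eta>])
      fix z assume "z \<in> E"
      then obtain j where "j \<in> I" "z \<in> cball (c j) (r j)" unfolding E_def by blast
      then show "norm (z - c i) \<le> r i \<or> s \<le> norm (z - c i)"
        using near far by blast
    qed blast
    have "norm (\<phi> z - (if j = i then 1 else 0)) < \<eta>" if "j \<in> I" "z \<in> cball (c j) (r j)" for j z
      using \<phi>(2,3)[of z] near far that by (auto simp: E_def)
    with \<phi>(1) show ?thesis by blast
  qed
  then obtain \<phi> where \<phi>: "\<And>i. i \<in> I \<Longrightarrow> \<phi> i \<in> entire"
    "\<And>i j z. i \<in> I \<Longrightarrow> j \<in> I \<Longrightarrow> z \<in> cball (c j) (r j) \<Longrightarrow> norm (\<phi> i z - (if j = i then 1 else 0)) < \<eta>"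
    by metis
  show ?thesis
  proof (rule that[of "\<lambda>z. \<Sum>i\<in>I. \<phi> i z * f i z"])
    show "(\<lambda>z. \<Sum>i\<in>I. \<phi> i z * f i z) \<in> entire"
      using \<phi>(1) f unfolding entire_def by (auto intro!: holomorphic_intros)
    fix j z assume j: "j \<in> I" "z \<in> cball (c j) (r j)"
    then have z: "z \<in> E" by (auto simp: E_def)
    have "f j z = (\<Sum>i\<in>I. (if j = i then 1 else 0) * f i z)"
      using I j(1) by (simp add: if_distrib[of "\<lambda>x. x * _"] cong: if_cong)
    then have "dist (\<Sum>i\<in>I. \<phi> i z * f i z) (f j z)
        = norm (\<Sum>i\<in>I. (\<phi> i z - (if j = i then 1 else 0)) * f i z)"
      by (simp only: dist_norm sum_subtractf[symmetric] left_diff_distrib)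
    also have "\<dots> \<le> (\<Sum>i\<in>I. \<eta> * B)"
    proof (intro sum_norm_le)
      fix i assume "i \<in> I"
      then show "norm ((\<phi> i z - (if j = i then 1 else 0)) * f i z) \<le> \<eta> * B"
        unfolding norm_mult using \<phi>(2)[OF _ j, of i] B(2)[OF _ z, of i] \<eta>
        by (intro mult_mono) auto
    qed
    also have "\<dots> < \<eta> * B * (card I + 1)"
      using \<eta> B(1) by simp
    also have "\<dots> = \<epsilon>"
      using B(1) by (simp add: \<eta>_def)
    finally show "dist (\<Sum>i\<in>I. \<phi> i z * f i z) (f j z) < \<epsilon>" .
  qed
qed

section \<open>Density and Baire category in the space of entire functions\<close>

lemma openin_entire_contains_disc_neighbourhood:
  assumes "openin entire_topology U" "f \<in> U"
  obtains R \<epsilon> where "\<epsilon> > 0" "\<And>g. g \<in> entire \<Longrightarrow> (\<forall>z\<in>cball 0 R. dist (g z) (f z) < \<epsilon>) \<Longrightarrow> g \<in> U"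
proof -
  obtain K \<epsilon> where K: "compact K" "\<epsilon> > 0"
    and U: "\<forall>g\<in>entire. (\<forall>z\<in>K. dist (g z) (f z) < \<epsilon>) \<longrightarrow> g \<in> U"
    using assms unfolding openin_entire_topology entire_open_def by meson
  obtain R where "\<forall>z\<in>K. norm z \<le> R"
    using compact_imp_bounded[OF K(1)] unfolding bounded_iff by auto
  then have "K \<subseteq> cball 0 R" by auto
  with U show ?thesis by (intro that[of \<epsilon> R, OF K(2)]) auto
qed

lemma dense_in_entire_iff:
  assumes "S \<subseteq> entire"
  shows "entire_topology closure_of S = entire \<longleftrightarrow>
    (\<forall>f\<in>entire. \<forall>R. \<forall>\<epsilon>>0. \<exists>g\<in>S. \<forall>z\<in>cball 0 R. dist (g z) (f z) < \<epsilon>)"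
proof -
  have "entire_topology closure_of S = entire \<longleftrightarrow>
      (\<forall>T. openin entire_topology T \<and> T \<noteq> {} \<longrightarrow> S \<inter> T \<noteq> {})"
    using dense_intersects_open[of entire_topology S] by simp
  also have "\<dots> \<longleftrightarrow> (\<forall>f\<in>entire. \<forall>R. \<forall>\<epsilon>>0. \<exists>g\<in>S. \<forall>z\<in>cball 0 R. dist (g z) (f z) < \<epsilon>)"
  proof (intro iffI ballI allI impI)
    fix f R and \<epsilon> :: real
    assume L: "\<forall>T. openin entire_topology T \<and> T \<noteq> {} \<longrightarrow> S \<inter> T \<noteq> {}" and f: "f \<in> entire" and "\<epsilon> > 0"
    let ?T = "{g \<in> entire. \<forall>z\<in>cball 0 R. dist (g z) (f z) < \<epsilon>}"
    have "openin entire_topology ?T" using f by (intro openin_entire_basic) auto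
    moreover have "f \<in> ?T" using f \<open>\<epsilon> > 0\<close> by simp
    ultimately have "S \<inter> ?T \<noteq> {}" using L by blast
    then show "\<exists>g\<in>S. \<forall>z\<in>cball 0 R. dist (g z) (f z) < \<epsilon>" by blast
  next
    fix T assume R: "\<forall>f\<in>entire. \<forall>R. \<forall>\<epsilon>>0. \<exists>g\<in>S. \<forall>z\<in>cball 0 R. dist (g z) (f z) < \<epsilon>"
      and T: "openin entire_topology T \<and> T \<noteq> {}"
    then obtain f where f: "f \<in> T" by blast
    with T have "f \<in> entire" using openin_subset[of entire_topology T] by auto
    obtain R \<epsilon> where "\<epsilon> > 0" and U: "\<And>g. g \<in> entire \<Longrightarrow> (\<forall>z\<in>cball 0 R. dist (g z) (f z) < \<epsilon>) \<Longrightarrow> g \<in> T"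
      using openin_entire_contains_disc_neighbourhood[of T f] T f by metis
    then obtain g where "g \<in> S" "\<forall>z\<in>cball 0 R. dist (g z) (f z) < \<epsilon>"
      using R[rule_format, OF \<open>f \<in> entire\<close> \<open>\<epsilon> > 0\<close>, of R] by auto
    then have "g \<in> S \<inter> T" using U assms by blast
    then show "S \<inter> T \<noteq> {}" by blast
  qed
  finally show ?thesis .
qed

text \<open>
  The usual nested-ball argument, carried out with the neighbourhoods given by a centre \<open>f\<close>, a disc
  of radius \<open>R\<close> and a tolerance \<open>e\<close>. Completeness is the fact that a locally uniform limit of entire
  functions is entire.
\<close>

theorem Baire_category_entire:
  fixes U :: "nat \<Rightarrow> (complex \<Rightarrow> complex) set"
  assumes op: "\<And>n. openin entire_topology (U n)"
    and dense: "\<And>n. entire_topology closure_of (U n) = entire"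
  shows "entire_topology closure_of (\<Inter>n. U n) = entire"
proof -
  have sub: "U n \<subseteq> entire" for n using openin_subset[OF op[of n]] by simp
  define N where "N = (\<lambda>(f, R, e). {g \<in> entire. \<forall>z\<in>cball 0 R. dist (g z) (f z) \<le> e})"
  have N: "g \<in> N (f, R, e) \<longleftrightarrow> g \<in> entire \<and> (\<forall>z\<in>cball 0 R. dist (g z) (f z) \<le> e)" for g f R e
    by (simp add: N_def)
  \<comment> \<open>The radii grow beyond all bounds and the tolerances tend to 0, so the centres form a
  Cauchy sequence on each disc.\<close>
  have shrink: "\<exists>f' R' e'. f' \<in> entire \<and> 0 < e' \<and> e' \<le> (1/2) ^ Suc n \<and> real (Suc n) \<le> R' \<and>
      N (f', R', e') \<subseteq> U n \<inter> N (f, R, e)"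
    if f: "f \<in> entire" and e: "e > 0" for f R e n
  proof -
    obtain f' where f': "f' \<in> U n" "\<forall>z\<in>cball 0 R. dist (f' z) (f z) < e/2"
      using dense[of n, unfolded dense_in_entire_iff[OF sub], rule_format, OF f half_gt_zero[OF e], of R]
      by auto
    obtain R1 e1 where e1: "e1 > 0"
      and R1: "\<And>g. g \<in> entire \<Longrightarrow> (\<forall>z\<in>cball 0 R1. dist (g z) (f' z) < e1) \<Longrightarrow> g \<in> U n"
      using openin_entire_contains_disc_neighbourhood[OF op f'(1)] by metis
    define R' where "R' = max R (max R1 (real (Suc n)))"
    define e' where "e' = min (e/2) (min (e1/2) ((1/2) ^ Suc n))"
    have "e' > 0" using e e1 by (simp add: e'_def)
    have e': "e' \<le> e/2" "e' < e1" "e' \<le> (1/2) ^ Suc n"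
      unfolding e'_def using e1 by (auto simp: min_less_iff_disj)
    have "g \<in> U n \<inter> N (f, R, e)" if "g \<in> N (f', R', e')" for g
    proof
      have g: "g \<in> entire" "\<And>z. z \<in> cball 0 R' \<Longrightarrow> dist (g z) (f' z) \<le> e'"
        using that N by auto
      show "g \<in> U n"
      proof (rule R1[OF g(1)], rule ballI)
        fix z :: complex assume "z \<in> cball 0 R1"
        then have "z \<in> cball 0 R'" by (simp add: R'_def)
        then show "dist (g z) (f' z) < e1" using g(2) e'(2) by fastforce
      qed
      have "dist (g z) (f z) \<le> e" if "z \<in> cball 0 R" for z
      proof -
        have "z \<in> cball 0 R'" using that by (simp add: R'_def)
        then show ?thesis
          using dist_triangle[of "g z" "f z" "f' z"] g(2)[of z] e'(1) f'(2) that by fastforce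
      qed
      then show "g \<in> N (f, R, e)" using g(1) N by blast
    qed
    moreover have "real (Suc n) \<le> R'" by (simp add: R'_def)
    moreover have "f' \<in> entire" using f'(1) sub by blast
    ultimately show ?thesis using \<open>e' > 0\<close> e'(3) by blast
  qed
  have IntU: "(\<Inter>n. U n) \<subseteq> entire" using sub by blast
  show ?thesis
    unfolding dense_in_entire_iff[OF IntU]
  proof (intro ballI allI impI)
    fix f0 and R0 \<epsilon> :: real assume f0: "f0 \<in> entire" and \<epsilon>: "\<epsilon> > 0"
    define P where "P n x = (case x of (f, R, e) \<Rightarrow> f \<in> entire \<and> 0 < e \<and>
        (if n = 0 then x = (f0, R0, \<epsilon>/2) else e \<le> (1/2) ^ n \<and> real n \<le> R))" for n x
    define Q where "Q n x y \<longleftrightarrow> N y \<subseteq> U n \<inter> N x" for n x y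
    have "\<exists>s. \<forall>n. P n (s n) \<and> Q n (s n) (s (Suc n))"
    proof (rule dependent_nat_choice)
      show "\<exists>x. P 0 x" using f0 \<epsilon> by (intro exI[of _ "(f0, R0, \<epsilon>/2)"]) (simp add: P_def)
      fix x n assume "P n x"
      then obtain f R e where x: "x = (f, R, e)" "f \<in> entire" "0 < e" 
        by (cases x) (auto simp: P_def)
      then obtain f' R' e' where "f' \<in> entire" "0 < e'" "e' \<le> (1/2) ^ Suc n" "real (Suc n) \<le> R'"
        "N (f', R', e') \<subseteq> U n \<inter> N (f, R, e)"
        using shrink by blast
      then show "\<exists>y. P (Suc n) y \<and> Q n x y"
        by (intro exI[of _ "(f', R', e')"]) (simp add: P_def Q_def x)
    qed
    then obtain s where s: "\<And>n. P n (s n)" "\<And>n. N (s (Suc n)) \<subseteq> U n \<inter> N (s n)"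
      unfolding Q_def by blast
    define F where "F n = fst (s n)" for n
    define R where "R n = fst (snd (s n))" for n
    define e where "e n = snd (snd (s n))" for n
    have s_eq: "s n = (F n, R n, e n)" for n by (simp add: F_def R_def e_def)
    have F: "F n \<in> entire" and e0: "0 < e n" for n
      using s(1)[of n] by (auto simp: P_def s_eq)
    have e: "e n \<le> (1/2) ^ n" "real n \<le> R n" if "n > 0" for n
      using s(1)[of n] that by (auto simp: P_def s_eq)
    have start: "F 0 = f0" "R 0 = R0" "e 0 = \<epsilon>/2"
      using s(1)[of 0] by (auto simp: P_def s_eq)
    have anti: "N (s n) \<subseteq> N (s m)" if "m \<le> n" for m n
      using lift_Suc_antimono_le[of "\<lambda>n. N (s n)", OF _ that] s(2) by blast
    have close: "dist (F n z) (F m z) \<le> e m" if "m \<le> n" "z \<in> cball 0 (R m)" for m n z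
    proof -
      have "F n \<in> N (s n)" using F e0[of n] by (simp add: s_eq N less_imp_le)
      then have "F n \<in> N (s m)" using anti that(1) by blast
      then show ?thesis using that(2) by (simp add: s_eq N)
    qed
    have small: "\<exists>n>0. r \<le> real n \<and> (1/2::real) ^ n < d" if d: "d > 0" for r d :: real
    proof -
      obtain k where k: "(1/2::real) ^ k < d" using real_arch_pow_inv[of d "1/2"] d by auto
      define n where "n = max k (Suc (nat \<lceil>r\<rceil>))"
      have "(1/2::real) ^ n \<le> (1/2) ^ k" by (rule power_decreasing) (auto simp: n_def)
      then have "(1/2::real) ^ n < d" using k by linarith
      moreover have "r \<le> real n" unfolding n_def by linarith
      moreover have "n > 0" by (simp add: n_def)
      ultimately show ?thesis by blast
    qed
    have "Cauchy (\<lambda>n. F n z)" for z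
    proof (rule metric_CauchyI)
      fix d :: real assume "d > 0"
      then obtain n where n: "n > 0" "norm z \<le> real n" "(1/2::real) ^ n < d/2"
        using small[of "d/2" "norm z"] by auto
      have near: "dist (F k z) (F n z) < d/2" if "k \<ge> n" for k
        using close[OF that, of z] e[OF n(1)] n(2,3) by simp
      show "\<exists>M. \<forall>k\<ge>M. \<forall>l\<ge>M. dist (F k z) (F l z) < d"
        using near by (intro exI[of _ n]) (metis dist_commute dist_triangle_half_r)
    qed
    then obtain G where G: "\<And>z. (\<lambda>n. F n z) \<longlonglongrightarrow> G z"
      unfolding Cauchy_convergent_iff convergent_def by metis
    have GF: "dist (G z) (F n z) \<le> e n" if "z \<in> cball 0 (R n)" for n z
    proof (rule tendsto_upperbound)
      show "(\<lambda>k. dist (F k z) (F n z)) \<longlonglongrightarrow> dist (G z) (F n z)"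
        by (intro tendsto_dist G tendsto_const)
      show "\<forall>\<^sub>F k in sequentially. dist (F k z) (F n z) \<le> e n"
        using eventually_ge_at_top[of n] by eventually_elim (use close that in blast)
    qed simp
    have "G holomorphic_on UNIV"
    proof (rule holomorphic_uniform_sequence)
      show "F n holomorphic_on UNIV" for n using F entireD by blast
      fix x :: complex
      have "uniform_limit (cball x 1) F G sequentially"
      proof (rule uniform_limitI)
        fix d :: real assume "d > 0"
        then obtain n where n: "n > 0" "norm x + 1 \<le> real n" "(1/2::real) ^ n < d"
          using small by blast
        have "dist (F k z) (G z) < d" if "k \<ge> n" "z \<in> cball x 1" for k z
        proof -
          have "norm z \<le> norm x + 1"
            using that(2) norm_triangle_sub[of z x] by (simp add: dist_norm norm_minus_commute)
          then have "z \<in> cball 0 (R k)" using n(2) that(1) e(2)[of k] n(1) by simp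
          then have "dist (G z) (F k z) \<le> (1/2) ^ k" using GF e(1)[of k] n(1) that(1) by fastforce
          also have "(1/2::real) ^ k \<le> (1/2) ^ n" using that(1) by (intro power_decreasing) auto
          finally show ?thesis using n(3) by (simp add: dist_commute)
        qed
        then show "\<forall>\<^sub>F k in sequentially. \<forall>z\<in>cball x 1. dist (F k z) (G z) < d"
          unfolding eventually_sequentially by blast
      qed
      then show "\<exists>d>0. cball x d \<subseteq> UNIV \<and> uniform_limit (cball x d) F G sequentially"
        by (intro exI[of _ 1]) auto
    qed simp
    then have GN: "G \<in> N (s n)" for n
      using GF by (simp add: s_eq N entire_def)
    have "G \<in> U n" for n using GN[of "Suc n"] s(2)[of n] by blast
    moreover have "\<forall>z\<in>cball 0 R0. dist (G z) (f0 z) < \<epsilon>"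
      using GF[of _ 0] \<epsilon> unfolding start by fastforce
    ultimately show "\<exists>g\<in>\<Inter>n. U n. \<forall>z\<in>cball 0 R0. dist (g z) (f0 z) < \<epsilon>" by blast
  qed
qed

text \<open>
  Polynomials with coefficients in a countable dense subset of the plane: truncate the Taylor series
  and perturb the finitely many coefficients.
\<close>

lemma countable_dense_polynomials:
  obtains D where "countable D" "D \<subseteq> entire" "D \<noteq> {}"
    "\<And>f R \<epsilon>. f \<in> entire \<Longrightarrow> \<epsilon> > 0 \<Longrightarrow> \<exists>p\<in>D. \<forall>z\<in>cball 0 R. dist (p z) (f z) < \<epsilon>"
proof -
  obtain Q :: "complex set" where Q: "countable Q" "\<And>X. open X \<Longrightarrow> X \<noteq> {} \<Longrightarrow> \<exists>d\<in>Q. d \<in> X"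
    using countable_dense_setE by blast
  define D where "D = (\<lambda>cs z. \<Sum>i<length cs. cs ! i * z ^ i) ` lists Q"
  have approx: "\<exists>p\<in>D. \<forall>z\<in>cball 0 R. dist (p z) (f z) < \<epsilon>"
    if f: "f \<in> entire" and \<epsilon>: "\<epsilon> > 0" for f and R \<epsilon> :: real
  proof -
    define r where "r = max R 0"
    define a where "a n = (deriv ^^ n) f 0 / fact n" for n
    have sums: "(\<lambda>n. a n * z ^ n) sums f z" for z
      using holomorphic_power_series[of f 0 "norm z + 1" z] entireD[OF f] by (simp add: a_def)
    have summ: "summable (\<lambda>n. norm (a n * of_real r ^ n))"
      by (rule powser_insidea[OF sums_summable[OF sums[of "of_real (r + 1)"]]]) (simp add: r_def)
    have "norm (a n * z ^ n) \<le> norm (a n * of_real r ^ n)" if "z \<in> cball 0 r" for n z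
      using that by (auto simp: norm_mult norm_power r_def intro!: mult_left_mono power_mono)
    then have "uniform_limit (cball 0 r) (\<lambda>n z. \<Sum>i<n. a i * z ^ i) (\<lambda>z. \<Sum>i. a i * z ^ i) sequentially"
      by (rule Weierstrass_m_test[OF _ summ])
    then have "\<forall>\<^sub>F n in sequentially. \<forall>z\<in>cball 0 r. dist (\<Sum>i<n. a i * z ^ i) (f z) < \<epsilon>/2"
      using uniform_limitD[of _ _ _ _ "\<epsilon>/2"] \<epsilon> by (simp add: sums_unique[OF sums, symmetric])
    then obtain n where n: "\<forall>z\<in>cball 0 r. dist (\<Sum>i<n. a i * z ^ i) (f z) < \<epsilon>/2"
      unfolding eventually_sequentially by blast
    define M where "M = (\<Sum>i<n. r ^ i) + 1"
    have M: "M > 0" unfolding M_def r_def by (intro add_nonneg_pos sum_nonneg) auto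
    define \<delta> where "\<delta> = \<epsilon> / (2 * M)"
    have \<delta>: "\<delta> > 0" "\<delta> * M = \<epsilon>/2" using M \<epsilon> by (auto simp: \<delta>_def)
    have "\<exists>d\<in>Q. d \<in> ball (a i) \<delta>" for i using Q(2)[of "ball (a i) \<delta>"] \<delta>(1) by auto
    then obtain q where q: "\<And>i. q i \<in> Q" "\<And>i. dist (a i) (q i) < \<delta>" by (simp add: Bex_def) metis
    define p where "p z = (\<Sum>i<n. q i * z ^ i)" for z
    have "p \<in> D" unfolding D_def
    proof (rule image_eqI)
      show "p = (\<lambda>z. \<Sum>i<length (map q [0..<n]). map q [0..<n] ! i * z ^ i)"
        by (simp add: p_def fun_eq_iff)
      show "map q [0..<n] \<in> lists Q" using q(1) by auto
    qed
    moreover have "dist (p z) (f z) < \<epsilon>" if "z \<in> cball 0 R" for z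
    proof -
      have z: "norm z \<le> r" using that by (simp add: r_def)
      have "dist (p z) (\<Sum>i<n. a i * z ^ i) = norm (\<Sum>i<n. (q i - a i) * z ^ i)"
        by (simp add: p_def dist_norm sum_subtractf[symmetric] left_diff_distrib)
      also have "\<dots> \<le> (\<Sum>i<n. \<delta> * r ^ i)"
      proof (intro sum_norm_le)
        fix i show "norm ((q i - a i) * z ^ i) \<le> \<delta> * r ^ i"
          unfolding norm_mult norm_power
          using q(2)[of i] z \<delta>(1) by (intro mult_mono power_mono) (auto simp: dist_norm norm_minus_commute)
      qed
      also have "\<dots> \<le> \<delta> * M"
        using \<delta>(1) by (simp add: M_def sum_distrib_left[symmetric])
      finally have "dist (p z) (\<Sum>i<n. a i * z ^ i) \<le> \<epsilon>/2" using \<delta>(2) by simp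
      moreover have "dist (\<Sum>i<n. a i * z ^ i) (f z) < \<epsilon>/2" using n z by simp
      ultimately show ?thesis
        using dist_triangle[of "p z" "f z" "\<Sum>i<n. a i * z ^ i"] by simp
    qed
    ultimately show ?thesis by blast
  qed
  show ?thesis
  proof (rule that[OF _ _ _ approx])
    show "countable D" unfolding D_def using Q(1) by simp
    show "D \<subseteq> entire" unfolding D_def entire_def by (auto intro!: holomorphic_intros)
    show "D \<noteq> {}" unfolding D_def by auto
  qed auto
qed

section \<open>Covering a thin annulus by discs with separated images\<close>

text \<open>
  In a subsequence whose consecutive ratios are eventually less than \<open>q\<close>, the first term of modulus at
  least \<open>x\<close> cannot overshoot by more than the factor \<open>q\<close>.
\<close>

lemma ratio_index_less_imp_geometrically_dense:
  assumes nz: "\<And>n. \<Lambda> n \<noteq> 0" and lim: "filterlim \<Lambda> at_infinity sequentially"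
    and q: "ratio_index \<Lambda> < ereal q" "1 \<le> q"
  obtains X where "\<And>x. x \<ge> X \<Longrightarrow> \<exists>m. x \<le> norm (\<Lambda> m) \<and> norm (\<Lambda> m) \<le> q * x"
proof -
  obtain r :: "nat \<Rightarrow> nat" where r: "strict_mono r"
    and "limsup (\<lambda>n. ereal (norm (\<Lambda> (r (Suc n)) / \<Lambda> (r n)))) < ereal q"
    using q(1) unfolding ratio_index_def Inf_less_iff by auto
  then have "\<forall>\<^sub>F n in sequentially. ereal (norm (\<Lambda> (r (Suc n)) / \<Lambda> (r n))) < ereal q"
    by (intro Limsup_lessD)
  then obtain N where "\<And>n. n \<ge> N \<Longrightarrow> norm (\<Lambda> (r (Suc n)) / \<Lambda> (r n)) < q"
    unfolding eventually_sequentially by auto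
  then have step: "norm (\<Lambda> (r (Suc n))) < q * norm (\<Lambda> (r n))" if "n \<ge> N" for n
    using that nz[of "r n"] by (simp add: norm_divide divide_less_eq)
  have "filterlim (\<lambda>n. \<Lambda> (r n)) at_infinity sequentially"
    using filterlim_compose[OF lim filterlim_subseq[OF r]] .
  then have unbounded: "\<forall>\<^sub>F n in sequentially. x \<le> norm (\<Lambda> (r n))" for x
    using filterlim_at_infinity_imp_norm_at_top unfolding filterlim_at_top by blast
  show ?thesis
  proof (rule that[of "norm (\<Lambda> (r N))"])
    fix x assume x: "norm (\<Lambda> (r N)) \<le> x"
    define P where "P n \<longleftrightarrow> n \<ge> N \<and> x \<le> norm (\<Lambda> (r n))" for n
    define n where "n = (LEAST n. P n)"
    obtain k where "\<And>n. n \<ge> k \<Longrightarrow> x \<le> norm (\<Lambda> (r n))"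
      using unbounded unfolding eventually_sequentially by blast
    then have "P (max N k)" by (simp add: P_def)
    then have n: "P n" unfolding n_def by (rule LeastI)
    have "norm (\<Lambda> (r n)) \<le> q * x"
    proof (cases "n = N")
      case True
      have "1 * x \<le> q * x"
        using q(2) order_trans[OF norm_ge_zero x] by (intro mult_right_mono) auto
      then show ?thesis using x True by simp
    next
      case False
      then obtain j where j: "n = Suc j" "j \<ge> N"
        using n by (cases n) (auto simp: P_def)
      then have "\<not> P j" using not_less_Least[of j P] by (simp add: n_def)
      then have "norm (\<Lambda> (r j)) \<le> x" using j by (simp add: P_def)
      then have "q * norm (\<Lambda> (r j)) \<le> q * x" using q(2) by (intro mult_left_mono) auto
      then show ?thesis using step[OF j(2)] j(1) by simp
    qed
    then show "\<exists>m. x \<le> norm (\<Lambda> m) \<and> norm (\<Lambda> m) \<le> q * x" using n by (auto simp: P_def)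
  qed
qed

lemma finite_square_grid_in_cball:
  assumes "s > 0"
  shows "finite {(u::int, v::int). norm (of_real s * Complex (of_int u) (of_int v)) \<le> C}"
proof (rule finite_subset)
  let ?K = "\<lceil>C / s\<rceil>"
  show "{(u, v). norm (of_real s * Complex (of_int u) (of_int v)) \<le> C} \<subseteq> {-?K..?K} \<times> {-?K..?K}"
  proof clarify
    fix u v assume "norm (of_real s * Complex (of_int u) (of_int v)) \<le> C"
    then have "norm (Complex (of_int u) (of_int v)) \<le> C / s"
      using assms by (simp add: norm_mult field_simps)
    then have "\<bar>of_int u\<bar> \<le> C / s" "\<bar>of_int v\<bar> \<le> C / s"
      using abs_Re_le_cmod[of "Complex (of_int u) (of_int v)"] abs_Im_le_cmod[of "Complex (of_int u) (of_int v)"]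
      by auto
    then show "u \<in> {-?K..?K} \<and> v \<in> {-?K..?K}" by (simp add: abs_le_iff) linarith
  qed
qed simp

lemma congruent_grid_points_separated:
  fixes s :: real and u v u' v' :: int and L :: nat
  assumes "s \<ge> 0" "(u, v) \<noteq> (u', v')" "u mod L = u' mod L" "v mod L = v' mod L"
  shows "s * L \<le> dist (of_real s * Complex (of_int u) (of_int v)) (of_real s * Complex (of_int u') (of_int v'))"
proof -
  have far: "real L \<le> \<bar>of_int a - of_int b\<bar>" if "a mod L = b mod L" "a \<noteq> b" for a b :: int
  proof -
    have "int L dvd a - b" using that(1) by (simp add: mod_eq_dvd_iff)
    then have "int L \<le> \<bar>a - b\<bar>" using that(2) dvd_imp_le_int[of "a - b" "int L"] by auto
    then show ?thesis by linarith
  qed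
  define d where "d = Complex (of_int u - of_int u') (of_int v - of_int v')"
  have "real L \<le> \<bar>Re d\<bar> \<or> real L \<le> \<bar>Im d\<bar>"
    using far[OF assms(3)] far[OF assms(4)] assms(2) by (auto simp: d_def)
  then have "real L \<le> norm d"
    using abs_Re_le_cmod[of d] abs_Im_le_cmod[of d] by linarith
  moreover have "of_real s * Complex (of_int u) (of_int v) - of_real s * Complex (of_int u') (of_int v') = of_real s * d"
    by (simp add: d_def complex_eq_iff algebra_simps)
  ultimately show ?thesis
    using assms(1) by (simp add: dist_norm norm_mult mult_left_mono)
qed

lemma square_grid_net:
  assumes "s > 0"
  shows "dist a (of_real s * Complex (of_int \<lfloor>Re a / s\<rfloor>) (of_int \<lfloor>Im a / s\<rfloor>)) \<le> 2 * s"
proof -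
  have near: "\<bar>x - s * of_int \<lfloor>x / s\<rfloor>\<bar> \<le> s" for x
  proof -
    have "\<bar>x / s - of_int \<lfloor>x / s\<rfloor>\<bar> \<le> 1" by linarith
    then have "s * \<bar>x / s - of_int \<lfloor>x / s\<rfloor>\<bar> \<le> s * 1" using assms by (intro mult_left_mono) auto
    moreover have "s * \<bar>x / s - of_int \<lfloor>x / s\<rfloor>\<bar> = \<bar>s * (x / s - of_int \<lfloor>x / s\<rfloor>)\<bar>"
      using assms by (simp add: abs_mult)
    moreover have "s * (x / s - of_int \<lfloor>x / s\<rfloor>) = x - s * of_int \<lfloor>x / s\<rfloor>"
      using assms by (simp add: algebra_simps)
    ultimately show ?thesis by simp
  qed
  show ?thesis
    unfolding dist_norm using near[of "Re a"] near[of "Im a"]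
    by (intro order_trans[OF cmod_le]) simp
qed

text \<open>
  The factor \<open>t\<close> is chosen before \<open>\<rho>\<close> and \<open>R\<close>: it depends only on the number \<open>M = L * L\<close> of colours, hence
  on \<open>r / \<delta>\<close>. Colour \<open>i\<close> uses a term with modulus between \<open>x * t\<^bsup>4 * i\<^esup>\<close> and \<open>x * t\<^bsup>4 * i + 2\<^esup>\<close>. It maps the
  annulus into the moduli from \<open>x * \<rho> * t\<^bsup>4 * i\<^esup>\<close> to \<open>x * \<rho> * t\<^bsup>4 * i + 3\<^esup>\<close>, which leaves a factor \<open>t\<close> free before
  the next colour starts. Since \<open>t\<^bsup>4 * M\<^esup> = 2\<close>, all moduli are at most \<open>2 * x\<close>, so that one grid has the
  right spacing for all colours. The index set is the grid, that is, pairs of integers.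
\<close>

lemma annulus_cover_with_separated_images:
  fixes \<Lambda> :: "nat \<Rightarrow> complex"
  assumes dense: "\<And>q. q > 1 \<Longrightarrow> \<exists>X. \<forall>x\<ge>X. \<exists>m. x \<le> norm (\<Lambda> m) \<and> norm (\<Lambda> m) \<le> q * x"
    and r: "r > 0" and \<delta>: "\<delta> > 0"
  obtains t where "t > 1"
    "\<And>\<rho> R. \<rho> > 0 \<Longrightarrow> \<exists>(I :: (int \<times> int) set) m b. finite I \<and>
       (\<forall>i\<in>I. R < norm (\<Lambda> (m i) * b i)) \<and>
       (\<forall>i\<in>I. \<forall>j\<in>I. i \<noteq> j \<longrightarrow> r < dist (\<Lambda> (m i) * b i) (\<Lambda> (m j) * b j)) \<and>
       (\<forall>a. \<rho> \<le> norm a \<and> norm a \<le> t * \<rho> \<longrightarrow> (\<exists>i\<in>I. norm (\<Lambda> (m i) * (a - b i)) \<le> \<delta>))"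
proof -
  obtain L :: nat where L: "4 * r / \<delta> < real L" using reals_Archimedean2 by blast
  have L0: "L > 0" using L r \<delta> by (cases L) (auto simp: field_simps)
  define M where "M = L * L"
  have M0: "M > 0" using L0 by (simp add: M_def)
  define t where "t = root (4 * M) 2"
  have t: "t > 1" "t ^ (4 * M) = 2" using M0 by (auto simp: t_def)
  have "t ^ 2 > 1" using t(1) by simp
  then obtain X where X: "\<And>x. x \<ge> X \<Longrightarrow> \<exists>m. x \<le> norm (\<Lambda> m) \<and> norm (\<Lambda> m) \<le> t ^ 2 * x"
    using dense by blast
  show ?thesis
  proof (rule that[OF t(1)])
    fix \<rho> R :: real assume \<rho>: "\<rho> > 0"
    \<comment> \<open>Large enough for the terms of \<open>\<Lambda>\<close> to be available, for the images to avoid the disc of radius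
    \<open>R\<close>, and for the free factor \<open>t\<close> to amount to a gap of more than \<open>2 * \<delta> + r\<close>.\<close>
    define x where "x = Max {1, X, (R + \<delta>) / \<rho> + 1, (2 * \<delta> + r) / (\<rho> * (t - 1)) + 1}"
    have "1 \<le> x" and xX: "X \<le> x" and "(R + \<delta>) / \<rho> + 1 \<le> x"
      and "(2 * \<delta> + r) / (\<rho> * (t - 1)) + 1 \<le> x"
      by (simp_all add: x_def)
    then have "0 < x" "(R + \<delta>) / \<rho> < x" "(2 * \<delta> + r) / (\<rho> * (t - 1)) < x" by linarith+
    then have x: "0 < x" "R + \<delta> < x * \<rho>" "2 * \<delta> + r < x * \<rho> * (t - 1)"
      using \<rho> t(1) by (simp_all add: pos_divide_less_eq mult.assoc)
    \<comment> \<open>Each point is within \<open>2 * s\<close> of the grid, and the terms in use have modulus at most \<open>2 * x\<close>.\<close>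
    define s where "s = \<delta> / (4 * x)"
    have s: "s > 0" using \<delta> x(1) by (simp add: s_def)
    have sx: "2 * x * (2 * s) = \<delta>" using x(1) by (simp add: s_def)
    have sL: "r < x * (s * L)"
      using L \<delta> x(1) by (simp add: s_def field_simps)
    have "\<exists>m. x * t ^ (4 * i) \<le> norm (\<Lambda> m) \<and> norm (\<Lambda> m) \<le> x * t ^ (4 * i + 2)" for i
    proof -
      have "x * 1 \<le> x * t ^ (4 * i)" using t(1) x(1) by (intro mult_left_mono one_le_power) auto
      then have "X \<le> x * t ^ (4 * i)" using xX by simp
      moreover have "t ^ 2 * (x * t ^ (4 * i)) = x * t ^ (4 * i + 2)" by (simp add: power_add power2_eq_square)
      ultimately show ?thesis using X[of "x * t ^ (4 * i)"] by (simp only:)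
    qed
    then obtain n where n: "\<And>i. x * t ^ (4 * i) \<le> norm (\<Lambda> (n i))"
      "\<And>i. norm (\<Lambda> (n i)) \<le> x * t ^ (4 * i + 2)"
      by metis
    have n_ge: "x \<le> norm (\<Lambda> (n i))" for i
    proof -
      have "x * 1 \<le> x * t ^ (4 * i)" using t(1) x(1) by (intro mult_left_mono one_le_power) auto
      then show ?thesis using n(1)[of i] by simp
    qed
    have n_le: "norm (\<Lambda> (n i)) \<le> 2 * x" if "i < M" for i
    proof -
      have "t ^ (4 * i + 2) \<le> t ^ (4 * M)" using t(1) that by (intro power_increasing) auto
      then have "x * t ^ (4 * i + 2) \<le> x * 2" using x(1) t(2) by simp
      then show ?thesis using n(2)[of i] by simp
    qed
    define col where "col = (\<lambda>(u :: int, v :: int). nat (u mod int L) * L + nat (v mod int L))"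
    define b where "b = (\<lambda>(u :: int, v :: int). of_real s * Complex (of_int u) (of_int v))"
    define m where "m i = n (col i)" for i
    \<comment> \<open>The grid point near a point of the annulus may lie outside it by up to \<open>2 * s\<close>; this shifts the
    images by at most \<open>\<delta>\<close>.\<close>
    define I where "I = {i. \<rho> - 2 * s \<le> norm (b i) \<and> norm (b i) \<le> t * \<rho> + 2 * s}"
    have res: "nat (u mod L) < L" for u :: int
      using L0 by (simp add: nat_less_iff)
    have col_less: "col i < M" for i
    proof -
      obtain u v where i: "i = (u, v)" by (cases i)
      have "col i < nat (u mod L) * L + L" using res[of v] by (simp add: col_def i)
      also have "\<dots> = Suc (nat (u mod L)) * L" by simp
      also have "\<dots> \<le> L * L" using res[of u] by (intro mult_right_mono) auto
      finally show ?thesis by (simp add: M_def)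
    qed
    have col_eq: "u mod L = u' mod L \<and> v mod L = v' mod L" if "col (u, v) = col (u', v')" for u v u' v' :: int
    proof -
      have "col (u, v) div L = nat (u mod L)" "col (u', v') div L = nat (u' mod L)"
        "col (u, v) mod L = nat (v mod L)" "col (u', v') mod L = nat (v' mod L)"
        using res L0 by (simp_all add: col_def)
      then have "nat (u mod L) = nat (u' mod L)" "nat (v mod L) = nat (v' mod L)"
        using that by simp_all
      then show ?thesis using L0 by (simp add: eq_nat_nat_iff)
    qed
    have slack: "norm (\<Lambda> (m i)) * (2 * s) \<le> \<delta>" for i
      using mult_right_mono[OF n_le[OF col_less[of i]], of "2 * s"] s sx by (simp add: m_def)
    have lower: "x * t ^ (4 * col i) * \<rho> - \<delta> \<le> norm (\<Lambda> (m i) * b i)" if "i \<in> I" for i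
    proof -
      have "x * t ^ (4 * col i) * \<rho> \<le> norm (\<Lambda> (m i)) * \<rho>"
        using n(1) \<rho> by (simp add: m_def)
      moreover have "norm (\<Lambda> (m i)) * (\<rho> - 2 * s) \<le> norm (\<Lambda> (m i)) * norm (b i)"
        using that by (intro mult_left_mono) (auto simp: I_def)
      ultimately show ?thesis using slack[of i] by (simp add: norm_mult right_diff_distrib)
    qed
    have upper: "norm (\<Lambda> (m i) * b i) \<le> x * t ^ (4 * col i + 3) * \<rho> + \<delta>" if "i \<in> I" for i
    proof -
      have "norm (\<Lambda> (m i)) * (t * \<rho>) \<le> x * t ^ (4 * col i + 2) * (t * \<rho>)"
        using n(2) \<rho> t(1) by (intro mult_right_mono) (auto simp: m_def)
      moreover have "norm (\<Lambda> (m i)) * norm (b i) \<le> norm (\<Lambda> (m i)) * (t * \<rho> + 2 * s)"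
        using that by (intro mult_left_mono) (auto simp: I_def)
      moreover have "x * t ^ (4 * col i + 2) * (t * \<rho>) = x * t ^ (4 * col i + 3) * \<rho>"
        by (simp add: power_add eval_nat_numeral)
      ultimately show ?thesis
        using slack[of i] unfolding norm_mult distrib_left[of "norm (\<Lambda> (m i))"] by linarith
    qed
    have "finite I"
      by (rule finite_subset[OF _ finite_square_grid_in_cball[OF s, of "t * \<rho> + 2 * s"]])
        (auto simp: I_def b_def)
    moreover have "R < norm (\<Lambda> (m i) * b i)" if "i \<in> I" for i
    proof -
      have "x * \<rho> * 1 \<le> x * \<rho> * t ^ (4 * col i)"
        using x(1) \<rho> t(1) by (intro mult_left_mono one_le_power) auto
      then show ?thesis using lower[OF that] x(2) by (simp add: mult_ac)
    qed
    moreover have "r < dist (\<Lambda> (m i) * b i) (\<Lambda> (m j) * b j)" if ij: "i \<in> I" "j \<in> I" "i \<noteq> j" for i j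
    proof (cases "col i = col j")
      case True
      obtain u v u' v' where uv: "i = (u, v)" "j = (u', v')" by (cases i, cases j)
      have "s * L \<le> dist (b i) (b j)"
        using congruent_grid_points_separated[of s u v u' v' L] col_eq[of u v u' v'] s True ij(3)
        by (simp add: uv b_def)
      then have "x * (s * L) \<le> norm (\<Lambda> (m i)) * dist (b i) (b j)"
        using n_ge x(1) s by (intro mult_mono) (auto simp: m_def)
      also have "\<dots> = dist (\<Lambda> (m i) * b i) (\<Lambda> (m j) * b j)"
        by (simp add: m_def True dist_norm norm_mult[symmetric] right_diff_distrib)
      finally show ?thesis using sL by simp
    next
      case False
      have apart: "r < norm (\<Lambda> (m j) * b j) - norm (\<Lambda> (m i) * b i)"
        if "i \<in> I" "j \<in> I" "col i < col j" for i j
      proof -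
        have "t ^ (4 * col i + 4) \<le> t ^ (4 * col j)"
          using t(1) that(3) by (intro power_increasing) auto
        then have "x * \<rho> * t ^ (4 * col i + 4) \<le> x * \<rho> * t ^ (4 * col j)"
          using x(1) \<rho> by (intro mult_left_mono) auto
        moreover have "x * \<rho> * (t - 1) * 1 \<le> x * \<rho> * (t - 1) * t ^ (4 * col i + 3)"
          using x(1) \<rho> t(1) by (intro mult_left_mono one_le_power) auto
        moreover have "x * \<rho> * (t - 1) * t ^ (4 * col i + 3)
            = x * \<rho> * t ^ (4 * col i + 4) - x * \<rho> * t ^ (4 * col i + 3)"
          by (simp add: power_add eval_nat_numeral algebra_simps)
        moreover have "x * t ^ (4 * col j) * \<rho> = x * \<rho> * t ^ (4 * col j)"
          "x * t ^ (4 * col i + 3) * \<rho> = x * \<rho> * t ^ (4 * col i + 3)" by simp_all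
        ultimately show ?thesis
          using lower[OF that(2)] upper[OF that(1)] x(3) by linarith
      qed
      show ?thesis
        using apart[of i j] apart[of j i] ij False
          norm_triangle_ineq3[of "\<Lambda> (m i) * b i" "\<Lambda> (m j) * b j"]
        unfolding dist_norm by linarith
    qed
    moreover have "\<exists>i\<in>I. norm (\<Lambda> (m i) * (a - b i)) \<le> \<delta>"
      if a: "\<rho> \<le> norm a" "norm a \<le> t * \<rho>" for a
    proof
      let ?i = "(\<lfloor>Re a / s\<rfloor>, \<lfloor>Im a / s\<rfloor>)"
      have d: "norm (a - b ?i) \<le> 2 * s"
        using square_grid_net[OF s, of a] by (simp add: b_def dist_norm)
      then show "?i \<in> I"
        unfolding I_def using a norm_triangle_ineq3[of a "b ?i"] by auto
      have "norm (\<Lambda> (m ?i)) * norm (a - b ?i) \<le> norm (\<Lambda> (m ?i)) * (2 * s)"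
        using d by (intro mult_left_mono) auto
      then show "norm (\<Lambda> (m ?i) * (a - b ?i)) \<le> \<delta>"
        using slack[of ?i] by (simp add: norm_mult)
    qed
    ultimately show "\<exists>(I :: (int \<times> int) set) m b. finite I \<and>
       (\<forall>i\<in>I. R < norm (\<Lambda> (m i) * b i)) \<and>
       (\<forall>i\<in>I. \<forall>j\<in>I. i \<noteq> j \<longrightarrow> r < dist (\<Lambda> (m i) * b i) (\<Lambda> (m j) * b j)) \<and>
       (\<forall>a. \<rho> \<le> norm a \<and> norm a \<le> t * \<rho> \<longrightarrow> (\<exists>i\<in>I. norm (\<Lambda> (m i) * (a - b i)) \<le> \<delta>))"
      by (intro exI[of _ I] exI[of _ m] exI[of _ b]) simp
  qed
qed

section \<open>Functions with an approximating translate for each parameter\<close>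

definition orbit_approximators ::
  "(nat \<Rightarrow> complex) \<Rightarrow> complex set \<Rightarrow> (complex \<Rightarrow> complex) \<Rightarrow> real \<Rightarrow> real \<Rightarrow> (complex \<Rightarrow> complex) set" where
  "orbit_approximators \<Lambda> S h k \<epsilon> =
     {f \<in> entire. \<forall>a\<in>S. \<exists>n. \<forall>z\<in>cball 0 k. dist (f (z + \<Lambda> n * a)) (h z) < \<epsilon>}"

text \<open>
  Were this not open at \<open>f\<close>, there would be functions \<open>g n\<close> outside the set that tend to \<open>f\<close> locally
  uniformly, each with a parameter \<open>a n\<close> in \<open>S\<close> at which all translates fail. At a limit point \<open>l\<close> of these
  parameters some index \<open>m\<close> works for \<open>f\<close>, and the points at which it fails for \<open>g n\<close> and \<open>a n\<close> accumulate
  at a point at which it would fail for \<open>f\<close> and \<open>l\<close>.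
\<close>

lemma openin_orbit_approximators:
  assumes S: "compact S" and h: "h \<in> entire"
  shows "openin entire_topology (orbit_approximators \<Lambda> S h k \<epsilon>)"
  unfolding openin_entire_topology entire_open_def
proof (intro conjI ballI)
  show "orbit_approximators \<Lambda> S h k \<epsilon> \<subseteq> entire" by (auto simp: orbit_approximators_def)
  fix f assume fU: "f \<in> orbit_approximators \<Lambda> S h k \<epsilon>"
  then have f: "f \<in> entire" by (simp add: orbit_approximators_def)
  have isC: "isCont f z" "isCont h z" for z
    using entire_continuous_on[of _ UNIV] f h by (auto simp: continuous_on_eq_continuous_at)
  show "\<exists>K e. compact K \<and> e > 0 \<and>
      (\<forall>g\<in>entire. (\<forall>z\<in>K. dist (g z) (f z) < e) \<longrightarrow> g \<in> orbit_approximators \<Lambda> S h k \<epsilon>)"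
  proof (rule ccontr)
    assume neg: "\<not> ?thesis"
    have "\<exists>g. g \<in> entire \<and> (\<forall>z\<in>cball 0 (real n). dist (g z) (f z) < 1 / Suc n) \<and>
        g \<notin> orbit_approximators \<Lambda> S h k \<epsilon>" for n
    proof (rule ccontr)
      assume "\<not> ?thesis"
      then have "compact (cball (0::complex) (real n)) \<and> 1 / real (Suc n) > 0 \<and>
        (\<forall>g\<in>entire. (\<forall>z\<in>cball 0 (real n). dist (g z) (f z) < 1 / Suc n) \<longrightarrow> g \<in> orbit_approximators \<Lambda> S h k \<epsilon>)"
        by auto
      then show False using neg by blast
    qed
    then obtain g where g: "\<And>n. g n \<in> entire"
      "\<And>n z. z \<in> cball 0 (real n) \<Longrightarrow> dist (g n z) (f z) < 1 / Suc n"
      "\<And>n. g n \<notin> orbit_approximators \<Lambda> S h k \<epsilon>" by metis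
    have "\<exists>a\<in>S. \<forall>m. \<exists>z\<in>cball 0 k. \<epsilon> \<le> dist (g n (z + \<Lambda> m * a)) (h z)" for n
      using g(1,3)[of n] by (auto simp: orbit_approximators_def not_less)
    then obtain a where a: "\<And>n. a n \<in> S"
      "\<And>n m. \<exists>z\<in>cball 0 k. \<epsilon> \<le> dist (g n (z + \<Lambda> m * a n)) (h z)" by metis
    obtain l \<sigma> where l: "l \<in> S" "strict_mono \<sigma>" "(a \<circ> \<sigma>) \<longlonglongrightarrow> l"
      using S a(1) unfolding compact_def by meson
    obtain m where m: "\<And>z. z \<in> cball 0 k \<Longrightarrow> dist (f (z + \<Lambda> m * l)) (h z) < \<epsilon>"
      using fU l(1) unfolding orbit_approximators_def by blast
    have "\<exists>y. y \<in> cball 0 k \<and> \<epsilon> \<le> dist (g (\<sigma> n) (y + \<Lambda> m * a (\<sigma> n))) (h y)" for n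
      using a(2)[of "\<sigma> n" m] by blast
    then obtain y where y: "\<And>n. y n \<in> cball 0 k" "\<And>n. \<epsilon> \<le> dist (g (\<sigma> n) (y n + \<Lambda> m * a (\<sigma> n))) (h (y n))"
      by metis
    obtain z \<tau> where z: "z \<in> cball 0 k" "strict_mono \<tau>" "(y \<circ> \<tau>) \<longlonglongrightarrow> z"
      using y(1) compact_cball[of "0::complex" k] unfolding compact_def by meson
    define \<nu> where "\<nu> n = \<sigma> (\<tau> n)" for n
    have \<nu>: "strict_mono \<nu>" using l(2) z(2) by (simp add: \<nu>_def strict_mono_def)
    define w where "w n = y (\<tau> n) + \<Lambda> m * a (\<nu> n)" for n
    have ylim: "(\<lambda>n. y (\<tau> n)) \<longlonglongrightarrow> z" using z(3) by (simp add: o_def)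
    have alim: "(\<lambda>n. a (\<nu> n)) \<longlonglongrightarrow> l"
      using LIMSEQ_subseq_LIMSEQ[OF l(3) z(2)] by (simp add: o_def \<nu>_def)
    have wlim: "w \<longlonglongrightarrow> z + \<Lambda> m * l"
      unfolding w_def by (intro tendsto_intros ylim alim)
    obtain B where B: "\<And>n. norm (w n) \<le> B"
      using wlim convergent_imp_Bseq[of w] unfolding convergent_def Bseq_def by metis
    have "(\<lambda>n. dist (g (\<nu> n) (w n)) (f (w n))) \<longlonglongrightarrow> 0"
    proof (rule tendsto_sandwich[where f = "\<lambda>_. 0" and h = "\<lambda>n. 1 / real (Suc n)"])
      show "\<forall>\<^sub>F n in sequentially. dist (g (\<nu> n) (w n)) (f (w n)) \<le> 1 / Suc n"
        using eventually_ge_at_top[of "nat \<lceil>B\<rceil>"]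
      proof eventually_elim
        case (elim n)
        have "n \<le> \<nu> n" using \<nu> by (rule strict_mono_imp_increasing)
        then have "B \<le> real (\<nu> n)" using elim by linarith
        then have "dist (g (\<nu> n) (w n)) (f (w n)) < 1 / Suc (\<nu> n)"
          using B[of n] by (intro g(2)) simp
        also have "\<dots> \<le> 1 / Suc n" using \<open>n \<le> \<nu> n\<close> by (simp add: frac_le)
        finally show ?case by simp
      qed
      show "(\<lambda>n. 1 / real (Suc n)) \<longlonglongrightarrow> 0" by (rule LIMSEQ_Suc[OF lim_1_over_n])
    qed (auto intro!: always_eventually)
    moreover have "(\<lambda>n. dist (f (w n)) (h (y (\<tau> n)))) \<longlonglongrightarrow> dist (f (z + \<Lambda> m * l)) (h z)"
      by (intro tendsto_dist isCont_tendsto_compose[OF isC(1) wlim] isCont_tendsto_compose[OF isC(2) ylim])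
    ultimately have "(\<lambda>n. dist (g (\<nu> n) (w n)) (f (w n)) + dist (f (w n)) (h (y (\<tau> n))))
        \<longlonglongrightarrow> 0 + dist (f (z + \<Lambda> m * l)) (h z)"
      by (rule tendsto_add)
    moreover have "\<epsilon> \<le> dist (g (\<nu> n) (w n)) (f (w n)) + dist (f (w n)) (h (y (\<tau> n)))" for n
      using y(2)[of "\<tau> n"] dist_triangle[of "g (\<nu> n) (w n)" "h (y (\<tau> n))" "f (w n)"]
      by (simp add: w_def \<nu>_def)
    ultimately have "\<epsilon> \<le> 0 + dist (f (z + \<Lambda> m * l)) (h z)"
      by (intro tendsto_lowerbound[OF _ _ sequentially_bot]) (auto intro: always_eventually)
    then show False using m[OF z(1)] by simp
  qed
qed

text \<open>
  Given \<open>g\<close> and a disc about 0, a function close to \<open>g\<close> on that disc and close to translates of \<open>h\<close> on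
  discs of radius \<open>k + 1\<close> about the points \<open>\<Lambda> (m i) * b i\<close> of a separated cover is the required
  approximant: each parameter \<open>a\<close> of the annulus is so near some \<open>b i\<close> that passing from \<open>b i\<close> to \<open>a\<close> moves
  the argument by at most \<open>\<delta> \<le> 1\<close>.
\<close>

lemma dense_orbit_approximators_thin_annulus:
  fixes \<Lambda> :: "nat \<Rightarrow> complex"
  assumes dense: "\<And>q. q > 1 \<Longrightarrow> \<exists>X. \<forall>x\<ge>X. \<exists>m. x \<le> norm (\<Lambda> m) \<and> norm (\<Lambda> m) \<le> q * x"
    and h: "h \<in> entire" and k: "k \<ge> 0" and \<epsilon>: "\<epsilon> > 0"
  obtains t where "t > 1" "\<And>\<rho>. \<rho> > 0 \<Longrightarrow>
    entire_topology closure_of (orbit_approximators \<Lambda> {a. \<rho> \<le> norm a \<and> norm a \<le> t * \<rho>} h k \<epsilon>) = entire"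
proof -
  have "uniformly_continuous_on (cball 0 (k + 1)) h"
    using h by (intro compact_uniformly_continuous entire_continuous_on) auto
  then obtain d where d: "d > 0"
    "\<And>z z'. z \<in> cball 0 (k + 1) \<Longrightarrow> z' \<in> cball 0 (k + 1) \<Longrightarrow> dist z' z < d \<Longrightarrow> dist (h z') (h z) < \<epsilon>/2"
    unfolding uniformly_continuous_on_def using half_gt_zero[OF \<epsilon>] by metis
  define \<delta> where "\<delta> = min 1 (d / 2)"
  have \<delta>: "\<delta> > 0" "\<delta> \<le> 1" "\<delta> < d" using d(1) by (auto simp: \<delta>_def)
  have k2: "2 * (k + 1) > 0" using k by simp
  obtain t where t: "t > 1" and cover:
    "\<And>\<rho> R. \<rho> > 0 \<Longrightarrow> \<exists>(I :: (int \<times> int) set) m b. finite I \<and>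
       (\<forall>i\<in>I. R < norm (\<Lambda> (m i) * b i)) \<and>
       (\<forall>i\<in>I. \<forall>j\<in>I. i \<noteq> j \<longrightarrow> 2 * (k + 1) < dist (\<Lambda> (m i) * b i) (\<Lambda> (m j) * b j)) \<and>
       (\<forall>a. \<rho> \<le> norm a \<and> norm a \<le> t * \<rho> \<longrightarrow> (\<exists>i\<in>I. norm (\<Lambda> (m i) * (a - b i)) \<le> \<delta>))"
    using annulus_cover_with_separated_images[OF dense k2 \<delta>(1)] by metis
  show ?thesis
  proof (rule that[OF t])
    fix \<rho> :: real assume \<rho>: "\<rho> > 0"
    let ?U = "orbit_approximators \<Lambda> {a. \<rho> \<le> norm a \<and> norm a \<le> t * \<rho>} h k \<epsilon>"
    have sub: "?U \<subseteq> entire" by (auto simp: orbit_approximators_def)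
    show "entire_topology closure_of ?U = entire"
      unfolding dense_in_entire_iff[OF sub]
    proof (intro ballI allI impI)
      fix g and R e :: real assume g: "g \<in> entire" and e: "e > 0"
      define R' where "R' = max R 1"
      obtain I m b where I: "finite (I :: (int \<times> int) set)"
        and big: "\<And>i. i \<in> I \<Longrightarrow> R' + (k + 1) < norm (\<Lambda> (m i) * b i)"
        and sep: "\<And>i j. i \<in> I \<Longrightarrow> j \<in> I \<Longrightarrow> i \<noteq> j \<Longrightarrow> 2 * (k + 1) < dist (\<Lambda> (m i) * b i) (\<Lambda> (m j) * b j)"
        and cov: "\<And>a. \<rho> \<le> norm a \<Longrightarrow> norm a \<le> t * \<rho> \<Longrightarrow> \<exists>i\<in>I. norm (\<Lambda> (m i) * (a - b i)) \<le> \<delta>"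
        using cover[OF \<rho>, of "R' + (k + 1)"] by metis
      \<comment> \<open>The index \<open>None\<close> stands for the disc on which \<open>g\<close> is to be approximated.\<close>
      define w where "w i = \<Lambda> (m i) * b i" for i
      define c where "c = case_option 0 w"
      define r where "r = case_option R' (\<lambda>i :: int \<times> int. k + 1)"
      define F where "F = case_option g (\<lambda>i z. h (z - w i))"
      obtain f where f: "f \<in> entire"
        "\<And>i z. i \<in> insert None (Some ` I) \<Longrightarrow> z \<in> cball (c i) (r i) \<Longrightarrow> dist (f z) (F i z) < min e (\<epsilon>/2)"
      proof (rule simultaneous_approximation_on_discs[of "insert None (Some ` I)" r c F "min e (\<epsilon>/2)"])
        show "finite (insert None (Some ` I))" using I by simp
        show "0 < r i" for i using k by (cases i) (auto simp: r_def R'_def)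
        show "0 < min e (\<epsilon>/2)" using e \<epsilon> by simp
        have "(\<lambda>z. h (z - w i)) \<in> entire" for i
          using translation_entire[OF h, of "- w i"] by (simp add: translation_def)
        then show "F i \<in> entire" for i using g by (cases i) (auto simp: F_def)
        show "r i + r j < dist (c i) (c j)"
          if "i \<in> insert None (Some ` I)" "j \<in> insert None (Some ` I)" "i \<noteq> j" for i j
        proof (cases i; cases j)
          fix i' j' assume "i = Some i'" "j = Some j'"
          then show ?thesis using that sep[of i' j'] by (auto simp: r_def c_def w_def)
        next
          fix j' assume "i = None" "j = Some j'"
          then show ?thesis using that big[of j'] by (auto simp: r_def c_def w_def)
        next
          fix i' assume "i = Some i'" "j = None"
          then show ?thesis using that big[of i'] by (auto simp: r_def c_def w_def)
        qed (use that in auto)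
      qed blast
      have "f \<in> ?U"
        unfolding orbit_approximators_def
      proof (intro CollectI conjI ballI)
        show "f \<in> entire" by (fact f(1))
        fix a :: complex assume "a \<in> {a. \<rho> \<le> norm a \<and> norm a \<le> t * \<rho>}"
        then obtain i where i: "i \<in> I" "norm (\<Lambda> (m i) * (a - b i)) \<le> \<delta>" using cov by blast
        have "dist (f (z + \<Lambda> (m i) * a)) (h z) < \<epsilon>" if z: "z \<in> cball 0 k" for z
        proof -
          define z' where "z' = z + \<Lambda> (m i) * (a - b i)"
          have shift: "z + \<Lambda> (m i) * a = w i + z'" by (simp add: z'_def w_def algebra_simps)
          have z'z: "dist z' z \<le> \<delta>" using i(2) by (simp add: z'_def dist_norm)
          have z': "norm z' \<le> k + 1"
            using z \<delta>(2) z'z norm_triangle_sub[of z' z] by (simp add: dist_norm)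
          have "dist (f (w i + z')) (h z') < \<epsilon>/2"
            using f(2)[of "Some i" "w i + z'"] i(1) z' by (simp add: c_def r_def F_def dist_norm)
          moreover have "dist (h z') (h z) < \<epsilon>/2"
            using d(2)[of z z'] z z' z'z \<delta>(3) by simp
          ultimately show ?thesis
            unfolding shift using dist_triangle[of "f (w i + z')" "h z" "h z'"] by simp
        qed
        then show "\<exists>n. \<forall>z\<in>cball 0 k. dist (f (z + \<Lambda> n * a)) (h z) < \<epsilon>" by blast
      qed
      moreover have "dist (f z) (g z) < e" if "z \<in> cball 0 R" for z
        using f(2)[of None z] that by (simp add: c_def r_def F_def R'_def)
      ultimately show "\<exists>f\<in>?U. \<forall>z\<in>cball 0 R. dist (f z) (g z) < e" by blast
    qed
  qed
qed

section \<open>Common hypercyclic functions\<close>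

lemma HC_translation_iff:
  assumes "f \<in> entire"
  shows "f \<in> HC (\<lambda>n. translation (b n)) \<longleftrightarrow>
    (\<forall>h\<in>entire. \<forall>R. \<forall>\<epsilon>>0. \<exists>n. \<forall>z\<in>cball 0 R. dist (f (z + b n)) (h z) < \<epsilon>)"
proof -
  have "{translation (b n) f | n. True} \<subseteq> entire" using translation_entire[OF assms] by auto
  then have "f \<in> HC (\<lambda>n. translation (b n)) \<longleftrightarrow>
      (\<forall>h\<in>entire. \<forall>R. \<forall>\<epsilon>>0. \<exists>g\<in>{translation (b n) f | n. True}. \<forall>z\<in>cball 0 R. dist (g z) (h z) < \<epsilon>)"
    using assms unfolding HC_def by (simp only: dense_in_entire_iff mem_Collect_eq simp_thms)
  also have "\<dots> \<longleftrightarrow> (\<forall>h\<in>entire. \<forall>R. \<forall>\<epsilon>>0. \<exists>n. \<forall>z\<in>cball 0 R. dist (f (z + b n)) (h z) < \<epsilon>)"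
    by (simp add: Bex_def translation_def) metis
  finally show ?thesis .
qed

lemma geometric_annuli_cover:
  assumes t: "t > 1" and a: "a \<noteq> (0 :: 'a :: real_normed_vector)"
  obtains i :: int where "t powr i \<le> norm a" "norm a \<le> t * t powr i"
proof -
  define i where "i = \<lfloor>log t (norm a)\<rfloor>"
  have "t powr log t (norm a) = norm a" using t a by simp
  moreover have "t powr i \<le> t powr log t (norm a)"
    using t by (intro powr_mono) (auto simp: i_def)
  moreover have "t powr log t (norm a) \<le> t powr (1 + i)"
    using t by (intro powr_mono) (auto simp: i_def, linarith)
  ultimately show ?thesis using that[of i] t by (simp add: powr_add)
qed

theorem theorem1p1:
  fixes \<Lambda> :: "nat \<Rightarrow> complex"
  assumes "\<And>n. \<Lambda> n \<noteq> 0"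
    and "filterlim \<Lambda> at_infinity sequentially"
    and "ratio_index \<Lambda> = 1"
  shows "gdelta_in entire_topology (\<Inter>a\<in>UNIV - {0}. HC (\<lambda>n. translation (\<Lambda> n * a)))
    \<and> entire_topology closure_of (\<Inter>a\<in>UNIV - {0}. HC (\<lambda>n. translation (\<Lambda> n * a))) = entire
    \<and> (\<exists>f\<in>entire. \<forall>a. a \<noteq> 0 \<longrightarrow>
          entire_topology closure_of {(\<lambda>z. f (z + \<Lambda> n * a)) | n. True} = entire)"
proof -
  let ?H = "\<Inter>a\<in>UNIV - {0}. HC (\<lambda>n. translation (\<Lambda> n * a))"
  have dense: "\<exists>X. \<forall>x\<ge>X. \<exists>m. x \<le> norm (\<Lambda> m) \<and> norm (\<Lambda> m) \<le> q * x" if "q > 1" for q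
  proof -
    have "ratio_index \<Lambda> < ereal q" using assms(3) that by simp
    then show ?thesis
      using ratio_index_less_imp_geometrically_dense[OF assms(1,2), of q] that by (metis less_imp_le)
  qed
  obtain D where D: "countable D" "D \<subseteq> entire" "D \<noteq> {}"
    "\<And>f R \<epsilon>. f \<in> entire \<Longrightarrow> \<epsilon> > 0 \<Longrightarrow> \<exists>p\<in>D. \<forall>z\<in>cball 0 R. dist (p z) (f z) < \<epsilon>"
    using countable_dense_polynomials by metis
  have "\<forall>p k s. \<exists>t. p \<in> D \<longrightarrow> t > 1 \<and> (\<forall>\<rho>>0. entire_topology closure_of
      (orbit_approximators \<Lambda> {a. \<rho> \<le> norm a \<and> norm a \<le> t * \<rho>} p (real k) (1 / Suc s)) = entire)"
  proof (intro allI)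
    fix p and k s :: nat
    show "\<exists>t. p \<in> D \<longrightarrow> t > 1 \<and> (\<forall>\<rho>>0. entire_topology closure_of
      (orbit_approximators \<Lambda> {a. \<rho> \<le> norm a \<and> norm a \<le> t * \<rho>} p (real k) (1 / Suc s)) = entire)"
    proof (cases "p \<in> D")
      case True
      then have "p \<in> entire" using D(2) by blast
      obtain t where "t > 1" "\<And>\<rho>. \<rho> > 0 \<Longrightarrow> entire_topology closure_of
          (orbit_approximators \<Lambda> {a. \<rho> \<le> norm a \<and> norm a \<le> t * \<rho>} p (real k) (1 / Suc s)) = entire"
        using dense_orbit_approximators_thin_annulus[OF dense \<open>p \<in> entire\<close>, of "real k" "1 / Suc s"] by auto
      then show ?thesis by blast
    qed simp
  qed
  then obtain t where t: "\<And>p k s. p \<in> D \<Longrightarrow> t p k s > 1"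
    "\<And>p k s \<rho>. p \<in> D \<Longrightarrow> \<rho> > 0 \<Longrightarrow> entire_topology closure_of
      (orbit_approximators \<Lambda> {a. \<rho> \<le> norm a \<and> norm a \<le> t p k s * \<rho>} p (real k) (1 / Suc s)) = entire"
    by metis
  \<comment> \<open>For each fixed \<open>p\<close>, \<open>k\<close>, \<open>s\<close> these annuli, whose width is adapted to the triple, cover the
  punctured plane.\<close>
  define A where "A p k s i = {a :: complex. t p k s powr of_int i \<le> norm a \<and> norm a \<le> t p k s * t p k s powr of_int i}"
    for p k s and i :: int
  define V where "V = (\<lambda>(p, k, s, i). orbit_approximators \<Lambda> (A p k s i) p (real k) (1 / Suc s))"
  define J where "J = D \<times> (UNIV :: nat set) \<times> (UNIV :: nat set) \<times> (UNIV :: int set)"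
  have J: "countable J" "J \<noteq> {}" using D(1,3) by (auto simp: J_def)
  have op: "openin entire_topology (V j)" if "j \<in> J" for j
  proof -
    obtain p k s i where j: "j = (p, k, s, i)" "p \<in> D" using \<open>j \<in> J\<close> by (auto simp: J_def)
    have "A p k s i = cball 0 (t p k s * t p k s powr of_int i) - ball 0 (t p k s powr of_int i)"
      by (auto simp: A_def)
    then have "compact (A p k s i)" by (simp add: compact_diff)
    then show ?thesis unfolding j V_def using openin_orbit_approximators D(2) j(2) by auto
  qed
  have de: "entire_topology closure_of (V j) = entire" if "j \<in> J" for j
  proof -
    obtain p k s i where j: "j = (p, k, s, i)" "p \<in> D" using \<open>j \<in> J\<close> by (auto simp: J_def)
    have "t p k s powr of_int i > 0" using t(1)[OF j(2), of k s] by simp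
    then show ?thesis using t(2)[OF j(2)] unfolding j V_def A_def by simp
  qed
  have nonzero: "a \<noteq> 0" if "a \<in> A p k s i" "p \<in> D" for a p k s i
    using that t(1)[of p k s] by (auto simp: A_def)
  have H: "?H = (\<Inter>j\<in>J. V j)"
  proof (intro equalityI subsetI)
    fix f assume f: "f \<in> ?H"
    then have fe: "f \<in> entire" unfolding HC_def by blast
    show "f \<in> (\<Inter>j\<in>J. V j)"
    proof
      fix j assume "j \<in> J"
      then obtain p k s i where j: "j = (p, k, s, i)" "p \<in> D" by (auto simp: J_def)
      have "\<exists>n. \<forall>z\<in>cball 0 (real k). dist (f (z + \<Lambda> n * a)) (p z) < 1 / Suc s" if "a \<in> A p k s i" for a
      proof -
        have "f \<in> HC (\<lambda>n. translation (\<Lambda> n * a))" using f nonzero[OF that j(2)] by blast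
        then show ?thesis
          using HC_translation_iff[OF fe, of "\<lambda>n. \<Lambda> n * a"] D(2) j(2) by (simp add: subset_iff)
      qed
      then show "f \<in> V j" using fe by (simp add: V_def j orbit_approximators_def)
    qed
  next
    fix f assume f: "f \<in> (\<Inter>j\<in>J. V j)"
    then have fe: "f \<in> entire" using J(2) by (auto simp: V_def orbit_approximators_def split: prod.splits)
    show "f \<in> ?H"
    proof
      fix a :: complex assume "a \<in> UNIV - {0}"
      then have a: "a \<noteq> 0" by simp
      show "f \<in> HC (\<lambda>n. translation (\<Lambda> n * a))"
        unfolding HC_translation_iff[OF fe]
      proof (intro ballI allI impI)
        fix h and R \<epsilon> :: real assume h: "h \<in> entire" and \<epsilon>: "\<epsilon> > 0"
        obtain k where k: "R \<le> real k" using real_arch_simple by blast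
        obtain s where s: "1 / real (Suc s) < \<epsilon>/2"
          using nat_approx_posE[of "\<epsilon>/2"] \<epsilon> by auto
        obtain p where p: "p \<in> D" "\<forall>z\<in>cball 0 (real k). dist (p z) (h z) < \<epsilon>/2"
          using D(4)[OF h half_gt_zero[OF \<epsilon>]] by blast
        obtain i :: int where "t p k s powr i \<le> norm a" "norm a \<le> t p k s * t p k s powr i"
          using geometric_annuli_cover[OF t(1)[OF p(1)] a] by metis
        then have "a \<in> A p k s i" by (simp add: A_def)
        moreover have "f \<in> V (p, k, s, i)" using f p(1) by (auto simp: J_def)
        ultimately obtain n where n: "\<forall>z\<in>cball 0 (real k). dist (f (z + \<Lambda> n * a)) (p z) < 1 / Suc s"
          by (auto simp: V_def orbit_approximators_def)
        have "dist (f (z + \<Lambda> n * a)) (h z) < \<epsilon>" if "z \<in> cball 0 R" for z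
        proof -
          have z: "z \<in> cball 0 (real k)" using that k by simp
          have "dist (f (z + \<Lambda> n * a)) (p z) < \<epsilon>/2" using n z s by fastforce
          moreover have "dist (p z) (h z) < \<epsilon>/2" using p(2) z by blast
          ultimately show ?thesis
            using dist_triangle[of "f (z + \<Lambda> n * a)" "h z" "p z"] by simp
        qed
        then show "\<exists>n. \<forall>z\<in>cball 0 R. dist (f (z + \<Lambda> n * a)) (h z) < \<epsilon>" by blast
      qed
    qed
  qed
  have gd: "gdelta_in entire_topology ?H"
    unfolding H using J op by (intro gdelta_in_Inter) (auto intro: open_imp_gdelta_in)
  have "(\<Inter>j\<in>J. V j) = (\<Inter>n. V (from_nat_into J n))"
    using range_from_nat_into[OF J(2,1)] by (metis image_image)
  then have cl: "entire_topology closure_of ?H = entire"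
    unfolding H using Baire_category_entire[of "\<lambda>n. V (from_nat_into J n)"] op de from_nat_into[OF J(2)]
    by simp
  have "?H \<noteq> {}"
  proof
    assume "?H = {}"
    then have "entire = {}" using cl by simp
    then show False using D(2,3) by blast
  qed
  then obtain f where f: "f \<in> ?H" by blast
  have "f \<in> HC (\<lambda>n. translation (\<Lambda> n * a))" if "a \<noteq> 0" for a using f that by blast
  then have "f \<in> entire \<and> (\<forall>a. a \<noteq> 0 \<longrightarrow>
      entire_topology closure_of {(\<lambda>z. f (z + \<Lambda> n * a)) | n. True} = entire)"
    unfolding HC_def translation_def using zero_neq_one by blast
  then show ?thesis using gd cl by blast
qed

end
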